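(* Let "matching" denote either matchings throughout or $2$-matchings throughout (the statement holds for both readings). Let $s$ and $k_0\le k$ be positive integers, let $\beta \ge \alpha > 0$, and let $F$ be a graph on vertex set $[s]$, possibly with loops. There is $\varepsilon_0>0$ such that the following holds for every $0<\varepsilon\le\varepsilon_0$. Set $\delta = \frac{\varepsilon}{2}\left(\frac{\alpha}{56 s^3\beta}\right)^{2k}$, let $n>0$, let $N_1,\dots,N_s\le \beta n$ be positive integers and let $\alpha_1,\dots,\alpha_k\ge\alpha$. Denote $\mathcal{G} = F(N_1+\varepsilon n,\dots,N_s+\varepsilon n)$ and $\mathcal{G}'=F(N_1,\dots,N_s)$. Suppose that $G$ is a $k$-coloured spanning subgraph of $\mathcal{G}$ such that $d_G(u)\ge d_{\mathcal{G}}(u)-\delta n$ for every vertex $u$; for every $\ell\in[k_0]$ there is no $\ell$-coloured connected matching on at least $\alpha_\ell n$ vertices; and for every $\ell\in[k_0+1,k]$ there is no $\ell$-coloured connected matching on at least $\alpha_\ell n$ vertices contained in a non-bipartite $\ell$-coloured component. Then there exists a $k$-colouring $G'$ of $\mathcal{G}'$ such that for every $\ell\in[k_0]$ there is no $\ell$-coloured connected matching on at least $\alpha_\ell n$ vertices, and for every $\ell\in[k_0+1,k]$ there is no $\ell$-coloured connected matching on at least $\alpha_\ell n$ vertices contained in a non-bipartite $\ell$-coloured component. Moreover, there exists such a $G'$ containing an induced subgraph of $G$ with $N_i$ vertices from the set replacing vertex $i$ of $F$ for each $i\in[s]$ (i.e. $V(G')\subseteq V(G)$ consists of $N_i$ vertices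 of the $i$-th blob of $\mathcal{G}$ for each $i$, and every edge of $G$ between vertices of $V(G')$ has in $G'$ the colour it has in $G$).
   Context: For a graph $F$ on vertex set $[s]$, possibly with loops, and reals $m_1,\dots,m_s>0$, the blow-up $F(m_1,\dots,m_s)$ has vertex set $V_1\cup\dots\cup V_s$ (pairwise disjoint, $|V_i|=\lceil m_i\rceil$; $V_i$ is the set replacing vertex $i$), and its edges are the pairs $xy$, $x\ne y$, with $x\in V_i$, $y\in V_j$ for some $ij\in E(F)$. A $k$-coloured graph assigns each edge one of $k$ colours; a $k$-colouring of $\mathcal{G}'$ is such an assignment on all edges of $\mathcal{G}'$. For a colour $\ell$, an $\ell$-coloured component is a connected component of the graph formed by the edges of colour $\ell$. A $2$-matching is a collection of pairwise vertex-disjoint edges and odd cycles. An $\ell$-coloured connected (2-)matching is a (2-)matching all of whose edges have colour $\ell$ and which lies in a single $\ell$-coloured component; it is on at least $t$ vertices if it covers at least $t$ vertices. *)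

theory Defs
  imports Complex_Main "HOL-Library.FuncSet" "HOL-Library.Disjoint_Sets"
begin

text \<open>Graphs are given by sets of edges, each edge being the set of its endpoints; a loop at
  \<open>i\<close> is the singleton \<open>{i}\<close>.\<close>

definition loop_graph_on :: "'a set \<Rightarrow> 'a set set \<Rightarrow> bool" where
  "loop_graph_on X F \<longleftrightarrow> (\<forall>e\<in>F. \<exists>i\<in>X. \<exists>j\<in>X. e = {i, j})"

definition vertex_degree :: "'v set set \<Rightarrow> 'v \<Rightarrow> nat" where
  "vertex_degree E u = card {e \<in> E. u \<in> e}"

definition blow_up_edges :: "nat set set \<Rightarrow> (nat \<Rightarrow> 'v set) \<Rightarrow> 'v set set" where
  "blow_up_edges F V = {{x, y} | x y i j. {i, j} \<in> F \<and> x \<in> V i \<and> y \<in> V j \<and> x \<noteq> y}"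

text \<open>\<open>E\<close> is the edge set of a copy of $F(m_1,\dots,m_s)$ in which vertex \<open>i\<close> is replaced
  by the set \<open>V i\<close>.\<close>

definition is_blow_up ::
  "nat \<Rightarrow> nat set set \<Rightarrow> (nat \<Rightarrow> real) \<Rightarrow> (nat \<Rightarrow> 'v set) \<Rightarrow> 'v set set \<Rightarrow> bool" where
  "is_blow_up s F m V E \<longleftrightarrow>
     (\<forall>i\<in>{1..s}. finite (V i) \<and> int (card (V i)) = \<lceil>m i\<rceil>) \<and>
     disjoint_family_on V {1..s} \<and>
     E = blow_up_edges F V"

definition colour_class :: "'v set set \<Rightarrow> ('v set \<Rightarrow> nat) \<Rightarrow> nat \<Rightarrow> 'v set set" where
  "colour_class E c l = {e \<in> E. c e = l}"

text \<open>Vertex sets of the connected components of the graph formed by the edges in \<open>E\<close>.\<close>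

definition graph_components :: "'v set set \<Rightarrow> 'v set set" where
  "graph_components E = {{y. (x, y) \<in> {(u, v). {u, v} \<in> E}\<^sup>*} | x. x \<in> \<Union>E}"

definition bipartite_on :: "'v set set \<Rightarrow> 'v set \<Rightarrow> bool" where
  "bipartite_on E C \<longleftrightarrow>
     (\<exists>A B. A \<union> B = C \<and> A \<inter> B = {} \<and>
        (\<forall>e\<in>E. e \<subseteq> C \<longrightarrow> (\<exists>a\<in>A. \<exists>b\<in>B. e = {a, b})))"

text \<open>Matchings and 2-matchings are represented by their edge sets, so that the set of covered
  vertices is \<open>\<Union>M\<close> in both cases.\<close>

definition is_matching :: "'v set set \<Rightarrow> bool" where
  "is_matching M \<longleftrightarrow> (\<forall>e\<in>M. card e = 2) \<and> disjoint M"

definition is_odd_cycle :: "'v set set \<Rightarrow> bool" where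
  "is_odd_cycle C \<longleftrightarrow>
     (\<exists>vs. distinct vs \<and> 3 \<le> length vs \<and> odd (length vs) \<and>
        C = {{vs ! i, vs ! (Suc i mod length vs)} | i. i < length vs})"

definition is_two_matching :: "'v set set \<Rightarrow> bool" where
  "is_two_matching M \<longleftrightarrow>
     (\<exists>\<C>. M = \<Union>\<C> \<and>
        (\<forall>C\<in>\<C>. (\<exists>e. card e = 2 \<and> C = {e}) \<or> is_odd_cycle C) \<and>
        (\<forall>C\<in>\<C>. \<forall>D\<in>\<C>. C \<noteq> D \<longrightarrow> \<Union>C \<inter> \<Union>D = {}))"

text \<open>The component \<open>C\<close> contains a connected matching, in the sense of \<open>mt\<close>, on at least
  \<open>t\<close> vertices.\<close>

definition has_matching_in ::
  "('v set set \<Rightarrow> bool) \<Rightarrow> 'v set set \<Rightarrow> 'v set \<Rightarrow> real \<Rightarrow> bool" where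
  "has_matching_in mt E C t \<longleftrightarrow>
     (\<exists>M. mt M \<and> M \<subseteq> E \<and> \<Union>M \<subseteq> C \<and> t \<le> real (card (\<Union>M)))"

definition no_large_connected_matchings ::
  "('v set set \<Rightarrow> bool) \<Rightarrow> nat \<Rightarrow> nat \<Rightarrow> (nat \<Rightarrow> real) \<Rightarrow> 'v set set \<Rightarrow> ('v set \<Rightarrow> nat) \<Rightarrow> bool" where
  "no_large_connected_matchings mt k0 k t E c \<longleftrightarrow>
     (\<forall>l\<in>{1..k0}. \<not> (\<exists>C\<in>graph_components (colour_class E c l).
        has_matching_in mt (colour_class E c l) C (t l))) \<and>
     (\<forall>l\<in>{k0+1..k}. \<not> (\<exists>C\<in>graph_components (colour_class E c l).
        \<not> bipartite_on (colour_class E c l) C \<and>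
        has_matching_in mt (colour_class E c l) C (t l)))"

end

theory Submission
  imports Defs
begin

text \<open>Add edges of the blow-up to \<open>G\<close>, in arbitrary colours, as long as no large connected matching
  arises. If the missing edges have a vertex cover of at most \<open>\<epsilon> n\<close> vertices, deleting it (and some
  more vertices) gives \<open>G'\<close>. Otherwise there is a large matching of missing edges \<open>x y\<close>, which may be
  assumed to run between two fixed blobs. None of them can be added in any colour \<open>l\<close>, so either

  \<^item> \<open>x\<close> and \<open>y\<close> lie in different components of colour \<open>l\<close>, or
  \<^item> they lie on the same side of a bipartite component of colour \<open>l\<close>, or
  \<^item> adding \<open>x y\<close> raises the matching number of their component, and then, by Gallai's lemma or
    (for 2-matchings) by Koenig's theorem in the bipartite double cover, \<open>x\<close> and \<open>y\<close> belong to
    different parts of a family with no edges of colour \<open>l\<close> between its parts.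

  Assigning the components or parts at random to the \<open>x\<close>-side or the \<open>y\<close>-side, one keeps a constant
  proportion of the missing edges such that no edge of colour \<open>l\<close> joins a remaining \<open>x\<close> to a remaining
  \<open>y\<close>. After all \<open>k\<close> colours there is no edge at all between the remaining ends, and still there are
  more than \<open>\<delta> n\<close> of them, against the degree condition.\<close>

section \<open>Components\<close>

text \<open>Indexing components by a vertex avoids choosing representatives. A vertex
  \<open>x\<close> on no edge gets \<open>{x}\<close>, whereas \<open>graph_components\<close> lists
  only the components of vertices in \<open>\<Union>E\<close>.\<close>

definition comp_of :: "'v set set \<Rightarrow> 'v \<Rightarrow> 'v set" where
  "comp_of E x = {y. (x, y) \<in> {(u, v). {u, v} \<in> E}\<^sup>*}"

lemma comp_of_self: "x \<in> comp_of E x"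
  by (simp add: comp_of_def)

lemma comp_of_step: "y \<in> comp_of E x \<Longrightarrow> {y, z} \<in> E \<Longrightarrow> z \<in> comp_of E x"
  unfolding comp_of_def by (auto intro: rtrancl_into_rtrancl)

lemma comp_of_eq:
  assumes "y \<in> comp_of E x"
  shows "comp_of E y = comp_of E x"
proof -
  have "sym {(u, v). {u, v} \<in> E}" by (auto simp: sym_def insert_commute)
  then have "sym ({(u, v). {u, v} \<in> E}\<^sup>*)" by (rule sym_rtrancl)
  then show ?thesis using assms unfolding comp_of_def
    by (auto dest: symD intro: rtrancl_trans)
qed

lemma comp_of_edge: "{u, v} \<in> E \<Longrightarrow> comp_of E u = comp_of E v"
  by (metis comp_of_eq comp_of_self comp_of_step)

lemma comp_of_subset:
  assumes "x \<in> S" "\<And>u v. u \<in> S \<Longrightarrow> {u, v} \<in> E \<Longrightarrow> v \<in> S"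
  shows "comp_of E x \<subseteq> S"
proof
  fix y assume "y \<in> comp_of E x"
  then have "(x, y) \<in> {(u, v). {u, v} \<in> E}\<^sup>*" by (simp add: comp_of_def)
  then show "y \<in> S" by (induction rule: rtrancl_induct) (use assms in auto)
qed

lemma comp_of_edge_cases:
  assumes "e \<in> E" "card e = 2"
  shows "e \<subseteq> comp_of E x \<or> e \<inter> comp_of E x = {}"
proof -
  obtain u v where "e = {u, v}" using assms(2) by (meson card_2_iff)
  then show ?thesis using assms(1) comp_of_step[of u E x v] comp_of_step[of v E x u]
    by (auto simp: insert_commute)
qed

lemma graph_components_eq: "graph_components E = comp_of E ` \<Union>E"
  by (auto simp: graph_components_def comp_of_def)

lemma finite_comp_of:
  assumes "finite E" "\<forall>e\<in>E. card e = 2"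
  shows "finite (comp_of E x)"
proof -
  have "finite (\<Union>E)" using assms by (metis card.infinite finite_Union zero_neq_numeral)
  moreover have "comp_of E x \<subseteq> insert x (\<Union>E)" by (rule comp_of_subset) auto
  ultimately show ?thesis by (meson finite_insert finite_subset)
qed

text \<open>A connected graph on p vertices has at least p - 1 edges. A largest set \<open>S\<close>
  that contains \<open>x\<close> and satisfies the bound is closed under adjacency, because a
  neighbour outside \<open>S\<close> would bring a new edge with it.\<close>

lemma card_comp_of_le:
  assumes fin: "finite E" and two: "\<forall>e\<in>E. card e = 2"
  shows "card (comp_of E x) \<le> card {e\<in>E. e \<subseteq> comp_of E x} + 1"
proof -
  let ?P = "comp_of E x"
  define good where "good S \<longleftrightarrow> x \<in> S \<and> S \<subseteq> ?P \<and> card S \<le> card {e\<in>E. e \<subseteq> S} + 1" for S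
  have finP: "finite ?P" using finite_comp_of[OF fin two] .
  have "good {x}" by (simp add: good_def comp_of_self)
  moreover have "\<forall>S. good S \<longrightarrow> card S \<le> card ?P"
    using finP by (auto simp: good_def intro: card_mono)
  ultimately obtain S where S: "good S" and max: "\<And>T. good T \<Longrightarrow> card T \<le> card S"
    using ex_has_greatest_nat[of good "{x}" card "Suc (card ?P)"] by (metis le_imp_less_Suc)
  have finS: "finite S" using S finP by (auto simp: good_def intro: finite_subset)
  have "?P \<subseteq> S"
  proof (rule comp_of_subset)
    show "x \<in> S" using S by (simp add: good_def)
    fix u v assume u: "u \<in> S" and uv: "{u, v} \<in> E"
    show "v \<in> S"
    proof (rule ccontr)
      assume v: "v \<notin> S"
      have "insert {u, v} {e\<in>E. e \<subseteq> S} \<subseteq> {e\<in>E. e \<subseteq> insert v S}" using u uv by auto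
      then have "card (insert {u, v} {e\<in>E. e \<subseteq> S}) \<le> card {e\<in>E. e \<subseteq> insert v S}"
        using fin by (intro card_mono) auto
      moreover have "card (insert {u, v} {e\<in>E. e \<subseteq> S}) = Suc (card {e\<in>E. e \<subseteq> S})"
        using fin v by (subst card_insert_disjoint) auto
      moreover have "v \<in> ?P" using S u uv comp_of_step[of u E x v] by (auto simp: good_def)
      ultimately have "good (insert v S)" using S v finS by (auto simp: good_def)
      then show False using max[of "insert v S"] v finS by simp
    qed
  qed
  then show ?thesis using S by (auto simp: good_def)
qed

section \<open>Maximum matchings and Gallai's lemma\<close>

definition max_matching :: "'v set set \<Rightarrow> 'v set set \<Rightarrow> bool" where
  "max_matching E M \<longleftrightarrow>
     is_matching M \<and> M \<subseteq> E \<and> (\<forall>N. is_matching N \<and> N \<subseteq> E \<longrightarrow> card N \<le> card M)"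

lemma is_matching_iff:
  "is_matching M \<longleftrightarrow> (\<forall>e\<in>M. card e = 2) \<and> (\<forall>e\<in>M. \<forall>f\<in>M. \<forall>x. x \<in> e \<longrightarrow> x \<in> f \<longrightarrow> e = f)"
  unfolding is_matching_def pairwise_def disjnt_iff by blast

lemma matchingD: "is_matching M \<Longrightarrow> e \<in> M \<Longrightarrow> f \<in> M \<Longrightarrow> x \<in> e \<Longrightarrow> x \<in> f \<Longrightarrow> e = f"
  unfolding is_matching_iff by blast

lemma is_matching_mono: "is_matching M \<Longrightarrow> N \<subseteq> M \<Longrightarrow> is_matching N"
  unfolding is_matching_iff by blast

lemma card_Union_matching:
  assumes "is_matching M"
  shows "card (\<Union>M) = 2 * card M"
proof -
  have "card (\<Union>M) = (\<Sum>e\<in>M. card e)"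
    using assms by (intro card_Union_disjoint) (auto simp: is_matching_def intro: card_ge_0_finite)
  then show ?thesis using assms by (simp add: is_matching_def)
qed

lemma ex_max_matching:
  assumes "finite E"
  shows "\<exists>M. max_matching E M"
proof -
  define good where "good M \<longleftrightarrow> is_matching M \<and> M \<subseteq> E" for M
  have "good {}" by (simp add: good_def is_matching_def)
  moreover have "\<forall>M. good M \<longrightarrow> card M \<le> card E"
    using assms by (auto simp: good_def intro: card_mono)
  ultimately obtain M where "good M" "\<And>T. good T \<Longrightarrow> card T \<le> card M"
    using ex_has_greatest_nat[of good "{}" card "Suc (card E)"] by (metis le_imp_less_Suc)
  then show ?thesis by (auto simp: max_matching_def good_def)
qed

lemma is_matching_Un:
  assumes "is_matching M" "is_matching N" "\<Union>M \<inter> \<Union>N = {}"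
  shows "is_matching (M \<union> N)"
  using assms unfolding is_matching_iff by blast

text \<open>No edge of \<open>M \<union> N\<close> leaves \<open>P\<close>, so either matching may
  be replaced by the other inside \<open>P\<close>. As the reverse exchange cannot enlarge
  \<open>N\<close>, the matching \<open>M\<close> has no more edges inside \<open>P\<close> than
  \<open>N\<close>, and hence the exchange does not shrink \<open>M\<close>.\<close>

lemma max_matching_swap:
  assumes fin: "finite E" and M: "max_matching E M" and N: "max_matching E N"
    and P: "P = comp_of (M \<union> N) x"
  shows "max_matching E ({e\<in>M. e \<inter> P = {}} \<union> {e\<in>N. e \<subseteq> P})"
proof -
  have two: "\<forall>e\<in>M \<union> N. card e = 2" using M N by (auto simp: max_matching_def is_matching_def)
  have cases: "e \<subseteq> P \<or> e \<inter> P = {}" if "e \<in> M \<union> N" for e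
    using comp_of_edge_cases[OF that, of x] two that P by auto
  have ne: "e \<noteq> {}" if "e \<in> M \<union> N" for e using two that by force
  have finMN: "finite M" "finite N" using M N fin by (auto simp: max_matching_def intro: finite_subset)
  have match: "is_matching ({e\<in>A. e \<inter> P = {}} \<union> {e\<in>B. e \<subseteq> P})"
    if "is_matching A" "is_matching B" for A B
    using that by (intro is_matching_Un) (auto intro: is_matching_mono)
  have split: "card A = card {e\<in>A. e \<inter> P = {}} + card {e\<in>A. e \<subseteq> P}"
    if "A \<subseteq> M \<union> N" "finite A" for A
  proof -
    have "A = {e\<in>A. e \<inter> P = {}} \<union> {e\<in>A. e \<subseteq> P}" using cases that by auto
    moreover have "{e\<in>A. e \<inter> P = {}} \<inter> {e\<in>A. e \<subseteq> P} = {}" using ne that by force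
    ultimately show ?thesis using that(2)
      by (metis (no_types, lifting) card_Un_disjoint finite_Un)
  qed
  have swap: "card ({e\<in>A. e \<inter> P = {}} \<union> {e\<in>B. e \<subseteq> P})
      = card {e\<in>A. e \<inter> P = {}} + card {e\<in>B. e \<subseteq> P}"
    if "A \<subseteq> M \<union> N" "finite A" "finite B" for A B
    using that ne by (intro card_Un_disjoint) fastforce+
  have "card ({e\<in>N. e \<inter> P = {}} \<union> {e\<in>M. e \<subseteq> P}) \<le> card N"
    using N M match[of N M] unfolding max_matching_def by blast
  then have "card {e\<in>M. e \<subseteq> P} \<le> card {e\<in>N. e \<subseteq> P}"
    using swap[of N M] split[of N] finMN by simp
  then have "card M \<le> card ({e\<in>M. e \<inter> P = {}} \<union> {e\<in>N. e \<subseteq> P})"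
    using swap[of M N] split[of M] finMN by simp
  then show ?thesis using M N match[of M N] unfolding max_matching_def
    by (auto intro: order_trans)
qed

text \<open>Gallai's lemma: being missed together by no maximum matching is a transitive relation.\<close>

lemma gallai_lemma:
  assumes fin: "finite E"
    and M: "max_matching E M" "u \<notin> \<Union>M" "w \<notin> \<Union>M" "u \<noteq> w"
    and N: "max_matching E N" "v \<notin> \<Union>N"
  shows "\<exists>M'. max_matching E M' \<and> v \<notin> \<Union>M' \<and> (u \<notin> \<Union>M' \<or> w \<notin> \<Union>M')"
proof (rule ccontr)
  assume *: "\<not> ?thesis"
  define P where "P = comp_of (M \<union> N) v"
  define M' where "M' = {e\<in>M. e \<inter> P = {}} \<union> {e\<in>N. e \<subseteq> P}"
  have M': "max_matching E M'"
    unfolding M'_def by (rule max_matching_swap[OF fin M(1) N(1) P_def])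
  have "v \<in> P" by (simp add: P_def comp_of_self)
  then have "v \<notin> \<Union>M'" using N(2) by (auto simp: M'_def)
  then have "u \<in> \<Union>M'" "w \<in> \<Union>M'" using * M' by blast+
  \<comment> \<open>\<open>M\<close> misses \<open>u\<close> and \<open>w\<close>, so the edges of
    \<open>M'\<close> covering them come from \<open>N\<close> and lie inside
    \<open>P\<close>.\<close>
  then have uw: "u \<in> P" "w \<in> P" using M by (auto simp: M'_def)
  have two: "\<forall>e\<in>M \<union> N. card e = 2"
    using M N by (auto simp: max_matching_def is_matching_def)
  have finMN: "finite (M \<union> N)"
    using M N fin by (auto simp: max_matching_def intro: finite_subset)
  have finP: "finite P" unfolding P_def by (rule finite_comp_of[OF finMN two])
  have "2 * card {e\<in>M. e \<subseteq> P} = card (\<Union>{e\<in>M. e \<subseteq> P})"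
    using M(1) by (subst card_Union_matching) (auto simp: max_matching_def intro: is_matching_mono)
  also have "\<dots> \<le> card (P - {u, w})" using M finP by (intro card_mono) auto
  also have "\<dots> = card P - 2" using uw M(4) by (subst card_Diff_subset) auto
  finally have m: "2 * card {e\<in>M. e \<subseteq> P} \<le> card P - 2" .
  have "2 * card {e\<in>N. e \<subseteq> P} = card (\<Union>{e\<in>N. e \<subseteq> P})"
    using N(1) by (subst card_Union_matching) (auto simp: max_matching_def intro: is_matching_mono)
  also have "\<dots> \<le> card (P - {v})" using N finP by (intro card_mono) auto
  also have "\<dots> = card P - 1" using \<open>v \<in> P\<close> by simp
  finally have n: "2 * card {e\<in>N. e \<subseteq> P} \<le> card P - 1" .
  \<comment> \<open>\<open>M\<close> misses two vertices of \<open>P\<close> and \<open>N\<close>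
    misses one. Together they have at most (p - 2)/2 + (p - 1)/2 edges in \<open>P\<close>, where p
    is \<open>card P\<close>; this is less than the p - 1 edges that connect
    \<open>P\<close>.\<close>
  have "card P \<le> card {e\<in>M \<union> N. e \<subseteq> P} + 1"
    unfolding P_def by (rule card_comp_of_le[OF finMN two])
  also have "{e\<in>M \<union> N. e \<subseteq> P} = {e\<in>M. e \<subseteq> P} \<union> {e\<in>N. e \<subseteq> P}" by auto
  also have "card \<dots> \<le> card {e\<in>M. e \<subseteq> P} + card {e\<in>N. e \<subseteq> P}" by (rule card_Un_le)
  finally have "card P \<le> card {e\<in>M. e \<subseteq> P} + card {e\<in>N. e \<subseteq> P} + 1" by simp
  moreover have "card {u, w} \<le> card P" using uw finP by (intro card_mono) auto
  ultimately show False using m n M(4) by simp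
qed

lemma max_matching_covers_edge:
  assumes "finite E" "{u, v} \<in> E" "u \<noteq> v" "max_matching E M"
  shows "u \<in> \<Union>M \<or> v \<in> \<Union>M"
proof (rule ccontr)
  assume *: "\<not> ?thesis"
  have "is_matching (M \<union> {{u, v}})"
    using * assms by (intro is_matching_Un) (auto simp: max_matching_def is_matching_def)
  then have "card (M \<union> {{u, v}}) \<le> card M" using assms by (simp add: max_matching_def)
  moreover have "finite M" using assms by (auto simp: max_matching_def intro: finite_subset)
  moreover have "{u, v} \<notin> M" using * by auto
  ultimately show False by simp
qed

text \<open>The structure that survives the addition of edges: \<open>D\<close> and \<open>lab\<close> play the role of the
  missable vertices and of the components they span in the Gallai--Edmonds decomposition.\<close>

definition edge_certificate ::
  "('v set set \<Rightarrow> bool) \<Rightarrow> 'v set set \<Rightarrow> 'v set \<Rightarrow> ('v \<Rightarrow> 'v set) \<Rightarrow> bool" where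
  "edge_certificate mt E D lab \<longleftrightarrow>
     (\<forall>u v. {u, v} \<in> E \<longrightarrow> u \<in> D \<longrightarrow> v \<in> D \<longrightarrow> lab u = lab v) \<and>
     (\<forall>x y M. x \<noteq> y \<longrightarrow> mt M \<longrightarrow> M \<subseteq> insert {x, y} E \<longrightarrow>
        (\<forall>M'. mt M' \<longrightarrow> M' \<subseteq> E \<longrightarrow> card (\<Union>M') < card (\<Union>M)) \<longrightarrow>
        x \<in> D \<and> y \<in> D \<and> lab x \<noteq> lab y)"

text \<open>\<open>D\<close> consists of the vertices missed by some maximum matching, and
  \<open>lab\<close> gives the classes of \<open>R\<close>, an equivalence on \<open>D\<close> by
  Gallai's lemma. No maximum matching misses both ends of an edge, so adjacent vertices of
  \<open>D\<close> share a class. If a new edge \<open>{x, y}\<close> raises the matching number,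
  removing it from the larger matching leaves a maximum matching of \<open>E\<close> that misses
  both ends.\<close>

lemma ex_edge_certificate_matching:
  assumes fin: "finite E" and two: "\<forall>e\<in>E. card e = 2"
  shows "\<exists>D lab. edge_certificate is_matching E D lab"
proof -
  define D where "D = {v. \<exists>M. max_matching E M \<and> v \<notin> \<Union>M}"
  define R where "R u v \<longleftrightarrow> u = v \<or> \<not> (\<exists>M. max_matching E M \<and> u \<notin> \<Union>M \<and> v \<notin> \<Union>M)" for u v
  define lab where "lab u = {v\<in>D. R u v}" for u
  have R_sym: "R u v \<longleftrightarrow> R v u" for u v by (auto simp: R_def)
  have R_trans: "R u w" if uvw: "R u v" "R v w" "v \<in> D" for u v w
  proof (rule ccontr)
    assume *: "\<not> R u w"
    then have "u \<noteq> v" "v \<noteq> w" using uvw(1,2) by auto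
    obtain M where M: "max_matching E M" "u \<notin> \<Union>M" "w \<notin> \<Union>M" "u \<noteq> w"
      using * by (auto simp: R_def)
    obtain N where N: "max_matching E N" "v \<notin> \<Union>N" using uvw(3) by (auto simp: D_def)
    obtain M' where "max_matching E M'" "v \<notin> \<Union>M'" "u \<notin> \<Union>M' \<or> w \<notin> \<Union>M'"
      using gallai_lemma[OF fin M N] by blast
    then show False using uvw(1,2) \<open>u \<noteq> v\<close> \<open>v \<noteq> w\<close> unfolding R_def by meson
  qed
  have 1: "lab u = lab v" if "{u, v} \<in> E" "u \<in> D" "v \<in> D" for u v
  proof -
    have "u \<noteq> v" using two that(1) by fastforce
    then have "R u v" using max_matching_covers_edge[OF fin that(1)] by (auto simp: R_def)
    then show ?thesis using R_trans R_sym that unfolding lab_def by blast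
  qed
  have 2: "x \<in> D \<and> y \<in> D \<and> lab x \<noteq> lab y"
    if xy: "x \<noteq> y" "is_matching M" "M \<subseteq> insert {x, y} E"
      and gr: "\<forall>M'. is_matching M' \<longrightarrow> M' \<subseteq> E \<longrightarrow> card (\<Union>M') < card (\<Union>M)" for x y M
  proof -
    have less: "card M' < card M" if "is_matching M'" "M' \<subseteq> E" for M'
      using gr that card_Union_matching[OF that(1)] card_Union_matching[OF xy(2)] by force
    have "{x, y} \<in> M" using less[OF xy(2)] xy(3) by blast
    define M0 where "M0 = M - {{x, y}}"
    have M0: "is_matching M0" "M0 \<subseteq> E" using xy by (auto simp: M0_def intro: is_matching_mono)
    have "finite M" using fin xy(3) by (meson finite_insert finite_subset)
    then have "card M = Suc (card M0)" using \<open>{x, y} \<in> M\<close> unfolding M0_def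
      by (metis card_Suc_Diff1)
    then have "max_matching E M0" using M0 less by (auto simp: max_matching_def less_Suc_eq_le)
    moreover have "x \<notin> \<Union>M0" "y \<notin> \<Union>M0"
      using matchingD[OF xy(2) \<open>{x, y} \<in> M\<close>] by (auto simp: M0_def)
    ultimately have "x \<in> D" "y \<in> D" "\<not> R x y" using xy(1) by (auto simp: D_def R_def)
    moreover from this have "y \<in> lab y" "y \<notin> lab x" by (auto simp: lab_def R_def)
    ultimately show ?thesis by auto
  qed
  show ?thesis unfolding edge_certificate_def
    by (intro exI[of _ D] exI[of _ lab] conjI allI impI) (use 1 2 in blast)+
qed

section \<open>Koenig's theorem and 2-matchings\<close>

lemma card_matching_le_cover:
  assumes "is_matching M" "\<forall>e\<in>M. e \<inter> S \<noteq> {}" "finite S"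
  shows "card M \<le> card S"
proof -
  define f where "f e = (SOME x. x \<in> e \<inter> S)" for e
  have f: "f e \<in> e \<inter> S" if "e \<in> M" for e
    using assms(2) that unfolding f_def by (meson ex_in_conv someI_ex)
  have "inj_on f M" using f by (intro inj_onI) (metis IntD1 assms(1) matchingD)
  moreover have "f ` M \<subseteq> S" using f by blast
  ultimately show ?thesis using card_inj_on_le assms(3) by blast
qed

text \<open>Exchanging along the component \<open>P\<close> of \<open>u\<close> forces
  \<open>v\<close> into \<open>P\<close>. Inside \<open>P\<close>, the edges of \<open>M\<close> use
  distinct vertices of \<open>L\<close> other than \<open>u\<close>, and those of \<open>N\<close>
  distinct vertices of \<open>R\<close> other than \<open>v\<close>. This leaves at most
  \<open>card P - 2\<close> edges, too few to connect \<open>P\<close>.\<close>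

lemma bipartite_edge_end_in_all_max_matchings:
  assumes fin: "finite E" and bip: "\<forall>e\<in>E. \<exists>a\<in>L. \<exists>b\<in>R. e = {a, b}" and LR: "L \<inter> R = {}"
    and uv: "{u, v} \<in> E" "u \<in> L" "v \<in> R"
    and M: "max_matching E M" "u \<notin> \<Union>M" and N: "max_matching E N" "v \<notin> \<Union>N"
  shows False
proof -
  define P where "P = comp_of (N \<union> M) u"
  define N' where "N' = {e\<in>N. e \<inter> P = {}} \<union> {e\<in>M. e \<subseteq> P}"
  have N': "max_matching E N'"
    unfolding N'_def by (rule max_matching_swap[OF fin N(1) M(1) P_def])
  have "u \<noteq> v" using uv LR by auto
  have "u \<in> P" by (simp add: P_def comp_of_self)
  then have "u \<notin> \<Union>N'" using M(2) by (auto simp: N'_def)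
  then have "v \<in> \<Union>N'" using max_matching_covers_edge[OF fin uv(1) \<open>u \<noteq> v\<close> N'] by auto
  \<comment> \<open>\<open>N\<close> misses \<open>v\<close>, so the edge of \<open>N'\<close> at
    \<open>v\<close> is an edge of \<open>M\<close> inside \<open>P\<close>.\<close>
  then have "v \<in> P" using N by (auto simp: N'_def)
  have two: "\<forall>e\<in>N \<union> M. card e = 2"
    using M N by (auto simp: max_matching_def is_matching_def)
  have finMN: "finite (N \<union> M)"
    using M N fin by (auto simp: max_matching_def intro: finite_subset)
  have finP: "finite P" unfolding P_def by (rule finite_comp_of[OF finMN two])
  have "card {e\<in>M. e \<subseteq> P} \<le> card (L \<inter> P - {u})"
  proof (rule card_matching_le_cover)
    show "is_matching {e\<in>M. e \<subseteq> P}"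
      using M by (auto simp: max_matching_def intro: is_matching_mono)
    show "\<forall>e\<in>{e\<in>M. e \<subseteq> P}. e \<inter> (L \<inter> P - {u}) \<noteq> {}"
    proof
      fix e assume e: "e \<in> {e\<in>M. e \<subseteq> P}"
      then have "e \<in> E" using M(1) by (auto simp: max_matching_def)
      then obtain a b where "a \<in> L" "e = {a, b}" using bip by blast
      then show "e \<inter> (L \<inter> P - {u}) \<noteq> {}" using e M(2) by auto
    qed
  qed (use finP in auto)
  then have m: "card {e\<in>M. e \<subseteq> P} \<le> card (L \<inter> P) - 1" using uv(2) \<open>u \<in> P\<close> by simp
  have "card {e\<in>N. e \<subseteq> P} \<le> card (R \<inter> P - {v})"
  proof (rule card_matching_le_cover)
    show "is_matching {e\<in>N. e \<subseteq> P}"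
      using N by (auto simp: max_matching_def intro: is_matching_mono)
    show "\<forall>e\<in>{e\<in>N. e \<subseteq> P}. e \<inter> (R \<inter> P - {v}) \<noteq> {}"
    proof
      fix e assume e: "e \<in> {e\<in>N. e \<subseteq> P}"
      then have "e \<in> E" using N(1) by (auto simp: max_matching_def)
      then obtain a b where "b \<in> R" "e = {a, b}" using bip by blast
      then show "e \<inter> (R \<inter> P - {v}) \<noteq> {}" using e N(2) by auto
    qed
  qed (use finP in auto)
  then have n: "card {e\<in>N. e \<subseteq> P} \<le> card (R \<inter> P) - 1" using uv(3) \<open>v \<in> P\<close> by simp
  have "card (L \<inter> P) + card (R \<inter> P) = card ((L \<inter> P) \<union> (R \<inter> P))"
    using finP LR by (intro card_Un_disjoint[symmetric]) auto
  also have "\<dots> \<le> card P" using finP by (intro card_mono) auto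
  also have "\<dots> \<le> card {e\<in>N \<union> M. e \<subseteq> P} + 1"
    unfolding P_def by (rule card_comp_of_le[OF finMN two])
  also have "{e\<in>N \<union> M. e \<subseteq> P} = {e\<in>M. e \<subseteq> P} \<union> {e\<in>N. e \<subseteq> P}" by auto
  also have "card \<dots> \<le> card {e\<in>M. e \<subseteq> P} + card {e\<in>N. e \<subseteq> P}" by (rule card_Un_le)
  finally have "card (L \<inter> P) + card (R \<inter> P) \<le> card {e\<in>M. e \<subseteq> P} + card {e\<in>N. e \<subseteq> P} + 1"
    by simp
  moreover have "0 < card (L \<inter> P)" "0 < card (R \<inter> P)"
    using uv \<open>u \<in> P\<close> \<open>v \<in> P\<close> finP by (auto simp: card_gt_0_iff)
  ultimately show False using m n by linarith
qed

text \<open>Induction on the number of edges. Some end \<open>z\<close> of a chosen edge is covered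
  by every maximum matching, so deleting \<open>z\<close> lowers the matching number, which pays for
  adding \<open>z\<close> to a cover of the remaining edges.\<close>

lemma konig:
  assumes "finite E" "\<forall>e\<in>E. \<exists>a\<in>L. \<exists>b\<in>R. e = {a, b}" "L \<inter> R = {}"
  shows "\<exists>M W. is_matching M \<and> M \<subseteq> E \<and> finite W \<and> (\<forall>e\<in>E. e \<inter> W \<noteq> {}) \<and> card W \<le> card M"
  using assms
proof (induction "card E" arbitrary: E rule: less_induct)
  case less
  show ?case
  proof (cases "E = {}")
    case True
    then show ?thesis by (intro exI[of _ "{}"]) (simp add: is_matching_def)
  next
    case False
    then obtain e where e: "e \<in> E" by blast
    then obtain u v where "u \<in> L" "v \<in> R" "e = {u, v}" using less.prems(2) by blast
    then have uv: "{u, v} \<in> E" "u \<in> L" "v \<in> R" using e by auto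
    have "\<exists>z\<in>{u, v}. \<forall>M. max_matching E M \<longrightarrow> z \<in> \<Union>M"
    proof (rule ccontr)
      assume "\<not> ?thesis"
      then obtain M N where "max_matching E M" "u \<notin> \<Union>M" "max_matching E N" "v \<notin> \<Union>N"
        by auto
      then show False by (rule bipartite_edge_end_in_all_max_matchings[OF less.prems uv])
    qed
    then obtain z where z: "z \<in> {u, v}" "\<And>M. max_matching E M \<Longrightarrow> z \<in> \<Union>M" by auto
    define E' where "E' = {e\<in>E. z \<notin> e}"
    have "E' \<subset> E" using uv z by (auto simp: E'_def)
    then have "card E' < card E" using less.prems(1) by (rule psubset_card_mono[rotated])
    then have "\<exists>M W. is_matching M \<and> M \<subseteq> E' \<and> finite W \<and> (\<forall>e\<in>E'. e \<inter> W \<noteq> {}) \<and> card W \<le> card M"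
      using less.prems by (intro less.hyps) (auto simp: E'_def)
    then obtain M' W' where M': "is_matching M'" "M' \<subseteq> E'" and W': "finite W'"
      "\<forall>e\<in>E'. e \<inter> W' \<noteq> {}" "card W' \<le> card M'" by blast
    obtain M where M: "max_matching E M" using ex_max_matching[OF less.prems(1)] by blast
    have "z \<notin> \<Union>M'" using M'(2) by (auto simp: E'_def)
    then have "\<not> max_matching E M'" using z(2) by blast
    moreover have "M' \<subseteq> E" using M'(2) by (auto simp: E'_def)
    ultimately have "card M' < card M" using M M'(1) unfolding max_matching_def
      by (metis le_trans linorder_not_less)
    moreover have "card (insert z W') \<le> Suc (card W')" by (rule card_insert_le_m1) auto
    ultimately have "card (insert z W') \<le> card M" using W'(3) by linarith
    moreover have "\<forall>e\<in>E. e \<inter> insert z W' \<noteq> {}" using W'(2) by (auto simp: E'_def)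
    ultimately show ?thesis using M W'(1) unfolding max_matching_def by (metis finite_insert)
  qed
qed

section \<open>Vertices covered by 2-matchings: upper bound by weights, construction from
  arcs\<close>

lemma is_two_matching_Un:
  assumes "is_two_matching M" "is_two_matching N" "\<Union>M \<inter> \<Union>N = {}"
  shows "is_two_matching (M \<union> N)"
proof -
  obtain A where A: "M = \<Union>A" "\<forall>C\<in>A. (\<exists>e. card e = 2 \<and> C = {e}) \<or> is_odd_cycle C"
    "\<forall>C\<in>A. \<forall>D\<in>A. C \<noteq> D \<longrightarrow> \<Union>C \<inter> \<Union>D = {}"
    using assms(1) unfolding is_two_matching_def by (elim exE conjE) (rule that)
  obtain B where B: "N = \<Union>B" "\<forall>C\<in>B. (\<exists>e. card e = 2 \<and> C = {e}) \<or> is_odd_cycle C"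
    "\<forall>C\<in>B. \<forall>D\<in>B. C \<noteq> D \<longrightarrow> \<Union>C \<inter> \<Union>D = {}"
    using assms(2) unfolding is_two_matching_def by (elim exE conjE) (rule that)
  have "\<Union>C \<inter> \<Union>D = {}" if "C \<in> A" "D \<in> B" for C D
    using assms(3) that unfolding A(1) B(1) by blast
  then have "\<forall>C\<in>A \<union> B. \<forall>D\<in>A \<union> B. C \<noteq> D \<longrightarrow> \<Union>C \<inter> \<Union>D = {}"
    using A(3) B(3) by (metis Un_iff inf_commute)
  then show ?thesis unfolding is_two_matching_def
    using A(1,2) B(1,2) by (intro exI[of _ "A \<union> B"]) auto
qed

lemma is_two_matching_if_matching:
  assumes "is_matching M"
  shows "is_two_matching M"
  unfolding is_two_matching_def
proof (intro exI[of _ "(\<lambda>e. {e}) ` M"] conjI)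
  show "\<forall>C\<in>(\<lambda>e. {e}) ` M. (\<exists>e. card e = 2 \<and> C = {e}) \<or> is_odd_cycle C"
    using assms by (simp add: is_matching_def)
  show "\<forall>C\<in>(\<lambda>e. {e}) ` M. \<forall>D\<in>(\<lambda>e. {e}) ` M. C \<noteq> D \<longrightarrow> \<Union>C \<inter> \<Union>D = {}"
    using matchingD[OF assms] by (simp add: disjoint_iff) blast
qed simp

lemma is_two_matching_if_odd_cycle: "is_odd_cycle C \<Longrightarrow> is_two_matching C"
  unfolding is_two_matching_def by (intro exI[of _ "{C}"]) auto

lemma bij_betw_Suc_mod:
  assumes "0 < p"
  shows "bij_betw (\<lambda>i. Suc i mod p) {..<p} {..<p}"
proof -
  have "inj_on (\<lambda>i. Suc i mod p) {..<p}"
    by (intro inj_onI) (auto simp: mod_Suc split: if_splits)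
  moreover have "(\<lambda>i. Suc i mod p) ` {..<p} \<subseteq> {..<p}" using assms by auto
  ultimately show ?thesis by (simp add: bij_betw_def endo_inj_surj)
qed

lemma Union_odd_cycle:
  assumes "C = {{vs ! i, vs ! (Suc i mod length vs)} | i. i < length vs}"
  shows "\<Union>C = set vs"
proof
  show "\<Union>C \<subseteq> set vs"
  proof
    fix x assume "x \<in> \<Union>C"
    then obtain i where "i < length vs" "x = vs ! i \<or> x = vs ! (Suc i mod length vs)"
      using assms by auto
    moreover from this have "Suc i mod length vs < length vs" by (intro mod_less_divisor) auto
    ultimately show "x \<in> set vs" by auto
  qed
  show "set vs \<subseteq> \<Union>C"
  proof
    fix x assume "x \<in> set vs"
    then obtain i where "i < length vs" "x = vs ! i" by (auto simp: in_set_conv_nth)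
    then have "{vs ! i, vs ! (Suc i mod length vs)} \<in> C" "x \<in> {vs ! i, vs ! (Suc i mod length vs)}"
      using assms by auto
    then show "x \<in> \<Union>C" by blast
  qed
qed

text \<open>Weak duality for the fractional vertex cover \<open>w / 2\<close>. On a single edge the
  bound is immediate; around an odd cycle the edge inequalities count every vertex twice.\<close>

lemma card_two_matching_le_weight:
  fixes w :: "'v \<Rightarrow> nat"
  assumes M: "is_two_matching M" "finite M" and w: "\<forall>u v. {u, v} \<in> M \<longrightarrow> 2 \<le> w u + w v"
  shows "card (\<Union>M) \<le> (\<Sum>v\<in>\<Union>M. w v)"
proof -
  obtain A where A: "M = \<Union>A" "\<forall>C\<in>A. (\<exists>e. card e = 2 \<and> C = {e}) \<or> is_odd_cycle C"
    "\<forall>C\<in>A. \<forall>D\<in>A. C \<noteq> D \<longrightarrow> \<Union>C \<inter> \<Union>D = {}"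
    using M(1) unfolding is_two_matching_def by (elim exE conjE) (rule that)
  have finA: "finite A" using A(1) M(2) by (metis finite_UnionD)
  have part: "finite (\<Union>C) \<and> card (\<Union>C) \<le> (\<Sum>v\<in>\<Union>C. w v)" if C: "C \<in> A" for C
    using A(2)[rule_format, OF C]
  proof
    assume "\<exists>e. card e = 2 \<and> C = {e}"
    then obtain u v where "u \<noteq> v" "C = {{u, v}}" by (metis card_2_iff)
    moreover from this have "2 \<le> w u + w v" using w A(1) C by blast
    ultimately show ?thesis by auto
  next
    assume "is_odd_cycle C"
    then obtain vs where vs: "distinct vs" "3 \<le> length vs"
      "C = {{vs ! i, vs ! (Suc i mod length vs)} | i. i < length vs}"
      unfolding is_odd_cycle_def by (elim exE conjE) (rule that)
    let ?p = "length vs"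
    have UC: "\<Union>C = set vs" using vs(3) by (rule Union_odd_cycle)
    have sumw: "(\<Sum>v\<in>set vs. w v) = (\<Sum>i<?p. w (vs ! i))"
      using sum.reindex_bij_betw[OF bij_betw_nth[OF vs(1) refl refl], of w] by simp
    \<comment> \<open>Shifting the index permutes the vertices of the cycle, so twice the total
      weight becomes a sum over the edges.\<close>
    also have "\<dots> = (\<Sum>i<?p. w (vs ! (Suc i mod ?p)))"
      using sum.reindex_bij_betw[OF bij_betw_Suc_mod, of ?p "\<lambda>i. w (vs ! i)"] vs(2)
      by (cases "vs = []") auto
    finally have "2 * (\<Sum>v\<in>set vs. w v) = (\<Sum>i<?p. w (vs ! i) + w (vs ! (Suc i mod ?p)))"
      using sumw by (simp add: sum.distrib)
    moreover have "(\<Sum>i<?p. 2) \<le> (\<Sum>i<?p. w (vs ! i) + w (vs ! (Suc i mod ?p)))"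
    proof (rule sum_mono)
      fix i assume "i \<in> {..<?p}"
      then have "{vs ! i, vs ! (Suc i mod ?p)} \<in> C" unfolding vs(3) by auto
      then have "{vs ! i, vs ! (Suc i mod ?p)} \<in> M" using A(1) C by blast
      then show "2 \<le> w (vs ! i) + w (vs ! (Suc i mod ?p))" using w by blast
    qed
    ultimately have "?p \<le> (\<Sum>v\<in>set vs. w v)" by simp
    then show ?thesis using UC vs(1) by (simp add: distinct_card)
  qed
  have UM: "\<Union>M = (\<Union>C\<in>A. \<Union>C)" using A(1) by auto
  have "card (\<Union>M) = (\<Sum>C\<in>A. card (\<Union>C))"
    unfolding UM using finA part A(3) by (intro card_UN_disjoint) auto
  also have "\<dots> \<le> (\<Sum>C\<in>A. \<Sum>v\<in>\<Union>C. w v)" using part by (intro sum_mono) auto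
  also have "\<dots> = (\<Sum>v\<in>\<Union>M. w v)"
    unfolding UM using finA part A(3) by (intro sum.UNION_disjoint[symmetric]) auto
  finally show ?thesis .
qed

text \<open>Injectivity pulls a repetition \<open>a i = a (i + d)\<close> back to the start, so the
  orbit is a cycle without a tail. The least period \<open>p\<close> makes the first
  \<open>p\<close> entries distinct.\<close>

lemma finite_injective_orbit:
  assumes S: "finite S" "\<And>x. x \<in> S \<Longrightarrow> g x \<in> S" "inj_on g S" and x: "x \<in> S"
  obtains a :: "nat \<Rightarrow> 'v" and p where "0 < p" "inj_on a {..<p}" "a p = a 0" "a 0 = x"
    "\<And>i. a i \<in> S" "\<And>i. a (Suc i) = g (a i)"
proof -
  define a where "a i = (g ^^ i) x" for i
  have a0: "a 0 = x" and aS: "a (Suc i) = g (a i)" for i by (auto simp: a_def)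
  have aiS: "a i \<in> S" for i by (induction i) (auto simp: a0 aS x S(2))
  have cancel: "a i = a (i + d) \<Longrightarrow> a d = a 0" for i d
    by (induction i) (use inj_onD[OF S(3)] aiS aS in auto)
  have "\<not> inj a"
  proof
    assume "inj a"
    moreover have "finite (range a)" using S(1) aiS by (meson finite_subset image_subsetI)
    ultimately show False using finite_imageD by blast
  qed
  then obtain i j where ij: "i < j" "a i = a j" by (metis injI linorder_neqE_nat)
  have ex: "0 < j - i \<and> a (j - i) = a 0" using cancel[of i "j - i"] ij by simp
  define p where "p = (LEAST d. 0 < d \<and> a d = a 0)"
  have p: "0 < p" "a p = a 0" using LeastI[of "\<lambda>d. 0 < d \<and> a d = a 0", OF ex] by (auto simp: p_def)
  have least: "\<not> (0 < d \<and> a d = a 0)" if "d < p" for d using that not_less_Least unfolding p_def by blast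
  have no: "a i \<noteq> a j" if "i < j" "j < p" for i j
    using cancel[of i "j - i"] least[of "j - i"] that by auto
  have "inj_on a {..<p}" by (intro inj_onI) (metis lessThan_iff linorder_neqE_nat no)
  then show ?thesis using that p a0 aiS aS by blast
qed

text \<open>For even \<open>p\<close> every second edge of the closed walk gives a perfect matching,
  which includes the degenerate case of a single edge walked back and forth. For odd
  \<open>p\<close> the walk itself is an odd cycle.\<close>

lemma cycle_two_matching:
  fixes a :: "nat \<Rightarrow> 'v"
  assumes p: "2 \<le> p" "inj_on a {..<p}" "a p = a 0"
  shows "\<exists>M. is_two_matching M \<and> M \<subseteq> {{a i, a (Suc i)} | i. i < p} \<and> \<Union>M = a ` {..<p}"
proof (cases "even p")
  case True
  have inj: "a i = a j \<longleftrightarrow> i = j" if "i < p" "j < p" for i j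
    using inj_on_eq_iff[OF p(2)] that by simp
  define M where "M = {{a (2 * i), a (2 * i + 1)} | i. 2 * i + 1 < p}"
  have "is_matching M"
    unfolding is_matching_iff
  proof (intro conjI ballI allI impI)
    fix e assume "e \<in> M"
    then obtain i where "2 * i + 1 < p" "e = {a (2 * i), a (2 * i + 1)}" unfolding M_def by blast
    moreover from this have "a (2 * i) \<noteq> a (2 * i + 1)" by (subst inj) auto
    ultimately show "card e = 2" by simp
  next
    fix e f x assume "e \<in> M" "f \<in> M" and x: "x \<in> e" "x \<in> f"
    then obtain i j where ij: "2 * i + 1 < p" "2 * j + 1 < p" "e = {a (2 * i), a (2 * i + 1)}"
      "f = {a (2 * j), a (2 * j + 1)}" unfolding M_def by blast
    then have "x = a (2 * i) \<or> x = a (2 * i + 1)" "x = a (2 * j) \<or> x = a (2 * j + 1)"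
      using x by auto
    then have "2 * i = 2 * j \<or> 2 * i + 1 = 2 * j \<or> 2 * i = 2 * j + 1 \<or> 2 * i + 1 = 2 * j + 1"
      using ij(1,2) inj by (metis add_lessD1)
    then have "i = j" by presburger
    then show "e = f" using ij by simp
  qed
  moreover have "M \<subseteq> {{a i, a (Suc i)} | i. i < p}" unfolding M_def by fastforce
  moreover have "\<Union>M = a ` {..<p}"
  proof
    show "\<Union>M \<subseteq> a ` {..<p}" by (auto simp: M_def)
    show "a ` {..<p} \<subseteq> \<Union>M"
    proof
      fix x assume "x \<in> a ` {..<p}"
      then obtain i where i: "i < p" "x = a i" by auto
      then have "2 * (i div 2) + 1 < p" "x \<in> {a (2 * (i div 2)), a (2 * (i div 2) + 1)}"
        using True by (presburger, cases "even i", auto)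
      then show "x \<in> \<Union>M" unfolding M_def by blast
    qed
  qed
  ultimately show ?thesis using is_two_matching_if_matching by blast
next
  case False
  define vs where "vs = map a [0..<p]"
  define C where "C = {{vs ! i, vs ! (Suc i mod length vs)} | i. i < length vs}"
  have len: "length vs = p" by (simp add: vs_def)
  have "3 \<le> p" using p(1) False by (cases "p = 2") auto
  moreover have "distinct vs" using p(2) by (simp add: vs_def distinct_map lessThan_atLeast0)
  ultimately have "is_odd_cycle C" unfolding is_odd_cycle_def using False len C_def by blast
  moreover have "\<Union>C = a ` {..<p}" using Union_odd_cycle[OF C_def]
    by (simp add: vs_def lessThan_atLeast0)
  moreover have "C \<subseteq> {{a i, a (Suc i)} | i. i < p}"
  proof
    fix e assume "e \<in> C"
    then obtain i where i: "i < p" "e = {vs ! i, vs ! (Suc i mod p)}" unfolding C_def len by blast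
    moreover have "vs ! i = a i" using i by (simp add: vs_def)
    moreover have "vs ! (Suc i mod p) = a (Suc i)"
      using i p by (cases "Suc i = p") (auto simp: vs_def)
    ultimately show "e \<in> {{a i, a (Suc i)} | i. i < p}" by auto
  qed
  ultimately show ?thesis using is_two_matching_if_odd_cycle by blast
qed

text \<open>As a digraph, \<open>f\<close> has in- and out-degrees at most 1 and no loops, so it is
  a disjoint union of paths and directed cycles. The first arc of a path covers two vertices and
  meets at most two arcs; a directed cycle covers as many vertices as it has arcs. Such pieces are
  removed inductively.\<close>

lemma ex_two_matching_of_partial_injection:
  assumes "finite f" "\<And>u v. (u, v) \<in> f \<Longrightarrow> u \<noteq> v"
    "\<And>u v w. (u, v) \<in> f \<Longrightarrow> (u, w) \<in> f \<Longrightarrow> v = w" "\<And>u v w. (u, w) \<in> f \<Longrightarrow> (v, w) \<in> f \<Longrightarrow> u = v"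
  shows "\<exists>M. is_two_matching M \<and> M \<subseteq> {{u, v} | u v. (u, v) \<in> f} \<and> card f \<le> card (\<Union>M)"
  using assms
proof (induction "card f" arbitrary: f rule: less_induct)
  case less
  note fin = less.prems(1) and irr = less.prems(2) and sv = less.prems(3) and inj = less.prems(4)
  \<comment> \<open>Split off a two-matching on the vertex set \<open>X\<close>, losing at most \<open>card X\<close> arcs.\<close>
  have step: ?case
    if K: "is_two_matching K" "K \<subseteq> {{u, v} | u v. (u, v) \<in> f}" "\<Union>K = X" "finite X" "X \<noteq> {}"
      and X: "card {(u, v)\<in>f. u \<in> X \<or> v \<in> X} \<le> card X" for K X
  proof -
    define f' where "f' = {(u, v)\<in>f. \<not> (u \<in> X \<or> v \<in> X)}"
    have split: "f = f' \<union> {(u, v)\<in>f. u \<in> X \<or> v \<in> X}" by (auto simp: f'_def)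
    have "f' \<noteq> f"
    proof
      assume "f' = f"
      then have "\<Union>K \<inter> X = {}" using K(2) by (fastforce simp: f'_def)
      then show False using K by auto
    qed
    then have "f' \<subset> f" by (auto simp: f'_def)
    then have "card f' < card f" using fin by (rule psubset_card_mono[rotated])
    then have "\<exists>M. is_two_matching M \<and> M \<subseteq> {{u, v} | u v. (u, v) \<in> f'} \<and> card f' \<le> card (\<Union>M)"
    proof (rule less.hyps)
      show "finite f'" using \<open>f' \<subset> f\<close> fin by (meson finite_subset psubset_imp_subset)
      show "u \<noteq> v" if "(u, v) \<in> f'" for u v using that irr by (auto simp: f'_def)
      show "v = w" if "(u, v) \<in> f'" "(u, w) \<in> f'" for u v w
        using that sv[of u v w] by (auto simp: f'_def)
      show "u = v" if "(u, w) \<in> f'" "(v, w) \<in> f'" for u v w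
        using that inj[of u w v] by (auto simp: f'_def)
    qed
    then obtain M where M: "is_two_matching M" "M \<subseteq> {{u, v} | u v. (u, v) \<in> f'}"
      "card f' \<le> card (\<Union>M)" by blast
    have disj: "\<Union>M \<inter> \<Union>K = {}" using M(2) K(3) by (fastforce simp: f'_def)
    have "\<Union>M \<subseteq> fst ` f \<union> snd ` f" using M(2) by (force simp: f'_def)
    then have "finite (\<Union>M)" using fin by (meson finite_Un finite_imageI finite_subset)
    then have "card (\<Union>(M \<union> K)) = card (\<Union>M) + card X"
      using disj K(3,4) by (simp add: card_Un_disjoint)
    moreover have "card f \<le> card f' + card {(u, v)\<in>f. u \<in> X \<or> v \<in> X}"
      using card_Un_le[of f' "{(u, v)\<in>f. u \<in> X \<or> v \<in> X}"] unfolding split[symmetric] .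
    ultimately have "card f \<le> card (\<Union>(M \<union> K))" using M(3) X by linarith
    moreover have "{{u, v} | u v. (u, v) \<in> f'} \<subseteq> {{u, v} | u v. (u, v) \<in> f}"
      using \<open>f' \<subset> f\<close> by blast
    then have "M \<union> K \<subseteq> {{u, v} | u v. (u, v) \<in> f}" using M(2) K(2) by (meson Un_least order_trans)
    ultimately show ?thesis using is_two_matching_Un[OF M(1) K(1) disj] by blast
  qed
  consider "f = {}" | u v where "(u, v) \<in> f" "u \<notin> Range f" | "f \<noteq> {}" "Domain f \<subseteq> Range f"
    by blast
  then show ?case
  proof cases
    case 1
    have "is_two_matching {}" by (intro is_two_matching_if_matching) (simp add: is_matching_def)
    then show ?thesis using 1 by auto
  next
    case 2
    have "u \<noteq> v" using irr 2 by blast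
    \<comment> \<open>\<open>T\<close> holds the arc leaving \<open>v\<close>, if there is one.
      Nothing enters \<open>u\<close>, so \<open>(u, v)\<close> and \<open>T\<close> are all the
      arcs that meet \<open>{u, v}\<close>.\<close>
    define T where "T = {(a, b)\<in>f. a = v}"
    have "T \<subseteq> {(v, SOME b. (v, b) \<in> f)}" using sv someI[of "\<lambda>b. (v, b) \<in> f"] by (auto simp: T_def)
    then have "card T \<le> card {(v, SOME b. (v, b) \<in> f)}" by (intro card_mono) auto
    then have T: "card T \<le> 1" "finite T"
      using fin by (auto simp: T_def intro: finite_subset[OF _ fin])
    have "card {(a, b)\<in>f. a \<in> {u, v} \<or> b \<in> {u, v}} \<le> card (insert (u, v) T)"
      using 2 sv inj T(2) by (intro card_mono) (auto simp: T_def)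
    then have "card {(a, b)\<in>f. a \<in> {u, v} \<or> b \<in> {u, v}} \<le> 2"
      using T by (simp add: card_insert_if split: if_splits)
    moreover have "is_two_matching {{u, v}}"
      using \<open>u \<noteq> v\<close> by (intro is_two_matching_if_matching) (simp add: is_matching_def)
    ultimately show ?thesis using 2 \<open>u \<noteq> v\<close> by (intro step[of "{{u, v}}" "{u, v}"]) auto
  next
    case 3
    define g where "g u = (SOME v. (u, v) \<in> f)" for u
    have g: "(u, g u) \<in> f" if "u \<in> Domain f" for u
      using that unfolding g_def by (metis DomainE someI_ex)
    have g_eq: "v = g u" if "(u, v) \<in> f" for u v using sv[OF that g] that by blast
    have finD: "finite (Domain f)" "finite (Range f)" using fin by (auto simp: finite_Domain finite_Range)
    \<comment> \<open>Being an image of the domain, the range cannot be larger, so the two sets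
      coincide and \<open>g\<close> permutes them. The orbits of \<open>g\<close> are the directed
      cycles.\<close>
    have "Range f = g ` Domain f" using g g_eq by force
    then have "card (Range f) \<le> card (Domain f)" using finD card_image_le by metis
    then have DR: "Domain f = Range f" using 3(2) finD by (metis card_seteq)
    obtain x where x: "x \<in> Domain f" using 3(1) by auto
    have gD: "g u \<in> Domain f" if "u \<in> Domain f" for u using g[OF that] DR by blast
    have g_inj: "inj_on g (Domain f)" using g inj by (intro inj_onI) metis
    obtain a :: "nat \<Rightarrow> 'a" and p where a: "0 < p" "inj_on a {..<p}" "a p = a 0" "a 0 = x"
      "\<And>i. a i \<in> Domain f" "\<And>i. a (Suc i) = g (a i)"
      by (rule finite_injective_orbit[OF finD(1) gD g_inj x]) (assumption, rule that)
    have arc: "(a i, a (Suc i)) \<in> f" for i using g[OF a(5)] a(6) by simp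
    have "p \<noteq> 1" using irr[OF arc[of 0]] a(3) by auto
    then have "2 \<le> p" using a(1) by simp
    then obtain K where K: "is_two_matching K" "K \<subseteq> {{a i, a (Suc i)} | i. i < p}" "\<Union>K = a ` {..<p}"
      using cycle_two_matching[OF _ a(2,3)] by blast
    have "{(u, v)\<in>f. u \<in> a ` {..<p} \<or> v \<in> a ` {..<p}} \<subseteq> (\<lambda>u. (u, g u)) ` a ` {..<p}"
    proof clarify
      fix u v assume uv: "(u, v) \<in> f" and uv': "u \<in> a ` {..<p} \<or> v \<in> a ` {..<p}"
      from uv' have "u \<in> a ` {..<p}"
      proof
        assume "v \<in> a ` {..<p}"
        then obtain i where i: "i < p" "v = a i" by auto
        \<comment> \<open>The predecessor of \<open>i\<close> on the cycle; index 0 wraps around to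
          \<open>p - 1\<close> since \<open>a p = a 0\<close>.\<close>
        define j where "j = (if i = 0 then p - 1 else i - 1)"
        have "j < p" "v = a (Suc j)" using i a(1,3) by (auto simp: j_def)
        then show ?thesis using inj[OF uv] arc[of j] by auto
      qed
      then show "(u, v) \<in> (\<lambda>u. (u, g u)) ` a ` {..<p}" using g_eq[OF uv] by blast
    qed
    then have "card {(u, v)\<in>f. u \<in> a ` {..<p} \<or> v \<in> a ` {..<p}} \<le> card ((\<lambda>u. (u, g u)) ` a ` {..<p})"
      by (intro card_mono) auto
    also have "\<dots> \<le> card (a ` {..<p})" by (intro card_image_le) auto
    finally have "card {(u, v)\<in>f. u \<in> a ` {..<p} \<or> v \<in> a ` {..<p}} \<le> card (a ` {..<p})" .
    moreover have "{{a i, a (Suc i)} | i. i < p} \<subseteq> {{u, v} | u v. (u, v) \<in> f}" using arc by blast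
    ultimately show ?thesis using K(1,3) order_trans[OF K(2)] a(1)
      by (intro step[of K "a ` {..<p}"]) auto
  qed
qed

text \<open>A 2-matching \<open>K\<close> covering at least \<open>card M\<close> vertices comes
  from the matching \<open>M\<close> of the double cover, and \<open>card W \<le> card M\<close>
  makes \<open>K\<close> and the weights \<open>w\<close> optimal. A new edge with
  \<open>w x + w y \<ge> 2\<close> leaves the weights a valid bound, so only edges with smaller sum
  can help.\<close>

lemma ex_edge_certificate_two_matching:
  fixes E :: "'v set set"
  assumes fin: "finite E" and two: "\<forall>e\<in>E. card e = 2"
  shows "\<exists>D lab. edge_certificate is_two_matching E D lab"
proof -
  \<comment> \<open>Koenig's theorem in the bipartite double cover of \<open>E\<close> gives a minimum fractional vertex cover
    of \<open>E\<close> with values \<open>w / 2\<close>.\<close>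
  define B :: "('v + 'v) set set" where "B = {{Inl u, Inr v} | u v. {u, v} \<in> E}"
  have finU: "finite (\<Union>E)" using assms by (metis card.infinite finite_Union zero_neq_numeral)
  have "B \<subseteq> (\<lambda>(u, v). {Inl u, Inr v}) ` (\<Union>E \<times> \<Union>E)" by (auto simp: B_def)
  then have "finite B" using finU by (meson finite_SigmaI finite_imageI finite_subset)
  moreover have "\<forall>e\<in>B. \<exists>a\<in>range Inl. \<exists>b\<in>range Inr. e = {a, b}" by (auto simp: B_def)
  moreover have "range Inl \<inter> range Inr = ({} :: ('v + 'v) set)" by auto
  ultimately have "\<exists>M W. is_matching M \<and> M \<subseteq> B \<and> finite W \<and> (\<forall>e\<in>B. e \<inter> W \<noteq> {}) \<and> card W \<le> card M"
    by (rule konig)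
  then obtain M W where M: "is_matching M" "M \<subseteq> B" and W: "finite W" "\<forall>e\<in>B. e \<inter> W \<noteq> {}"
    and WM: "card W \<le> card M" by blast
  define w :: "'v \<Rightarrow> nat" where "w v = of_bool (Inl v \<in> W) + of_bool (Inr v \<in> W)" for v
  have w2: "2 \<le> w u + w v" if "{u, v} \<in> E" for u v
  proof -
    \<comment> \<open>Each edge occurs in \<open>B\<close> in both orientations, and
      \<open>W\<close> has to meet both.\<close>
    have "{v, u} \<in> E" using that by (simp add: insert_commute)
    then have "{Inl u, Inr v} \<in> B" "{Inl v, Inr u} \<in> B" using that by (auto simp: B_def)
    then have "Inl u \<in> W \<or> Inr v \<in> W" "Inl v \<in> W \<or> Inr u \<in> W" using W(2) by fastforce+
    then show ?thesis by (auto simp: w_def)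
  qed
  have sum_w: "(\<Sum>v\<in>S. w v) \<le> card W" if S: "finite S" for S
  proof -
    have "(\<Sum>v\<in>S. w v) = card {v\<in>S. Inl v \<in> W} + card {v\<in>S. Inr v \<in> W}"
      using S by (simp add: w_def sum.distrib Int_def flip: sum.inter_filter card_eq_sum)
    also have "\<dots> = card (Inl ` {v\<in>S. Inl v \<in> W} :: ('v + 'v) set)
        + card (Inr ` {v\<in>S. Inr v \<in> W} :: ('v + 'v) set)"
      by (simp add: card_image)
    also have "\<dots> = card (Inl ` {v\<in>S. Inl v \<in> W} \<union> Inr ` {v\<in>S. Inr v \<in> W})"
      using S by (intro card_Un_disjoint[symmetric]) auto
    also have "\<dots> \<le> card W" using W(1) by (intro card_mono) auto
    finally show ?thesis .
  qed
  define f where "f = {(u, v). {Inl u, Inr v} \<in> M}"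
  have fE: "{u, v} \<in> E" if "(u, v) \<in> f" for u v
    using that M(2) by (fastforce simp: f_def B_def doubleton_eq_iff)
  have M_eq: "M = (\<lambda>(u, v). {Inl u, Inr v}) ` f" using M(2) by (fastforce simp: f_def B_def)
  have inj: "inj_on (\<lambda>(u, v). {Inl u, Inr v}) f" by (auto simp: inj_on_def doubleton_eq_iff)
  have cardf: "card M = card f" using M_eq card_image[OF inj] by simp
  have "\<exists>K. is_two_matching K \<and> K \<subseteq> {{u, v} | u v. (u, v) \<in> f} \<and> card f \<le> card (\<Union>K)"
  proof (rule ex_two_matching_of_partial_injection)
    have "finite M" using M(2) \<open>finite B\<close> by (rule finite_subset)
    then show "finite f" using M_eq inj finite_imageD by metis
    show "u \<noteq> v" if "(u, v) \<in> f" for u v using fE[OF that] two by fastforce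
    show "v = z" if "(u, v) \<in> f" "(u, z) \<in> f" for u v z
    proof -
      have "{Inl u, Inr v} = {Inl u, Inr z}"
        using that by (intro matchingD[OF M(1), of _ _ "Inl u"]) (auto simp: f_def)
      then show ?thesis by (auto simp: doubleton_eq_iff)
    qed
    show "u = v" if "(u, z) \<in> f" "(v, z) \<in> f" for u v z
    proof -
      have "{Inl u, Inr z} = {Inl v, Inr z}"
        using that by (intro matchingD[OF M(1), of _ _ "Inr z"]) (auto simp: f_def)
      then show ?thesis by (auto simp: doubleton_eq_iff)
    qed
  qed
  then obtain K where K: "is_two_matching K" "K \<subseteq> {{u, v} | u v. (u, v) \<in> f}" "card f \<le> card (\<Union>K)"
    by blast
  have KE: "K \<subseteq> E" using K(2) fE by auto
  \<comment> \<open>The weights in \<open>D\<close> are 0 and 1. All neighbours of a vertex of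
    weight 0 have weight 2 and lie outside \<open>D\<close>, so it may carry a label of its own,
    while vertices of weight 1 share the label \<open>{}\<close>. Distinct vertices of total weight
    at most 1 therefore have different labels.\<close>
  define D where "D = {v. w v < 2}"
  define lab where "lab v = (if w v = 0 then {v} else {})" for v
  have "lab u = lab v" if "{u, v} \<in> E" "u \<in> D" "v \<in> D" for u v
    using w2[OF that(1)] that(2,3) by (auto simp: lab_def D_def)
  moreover have "x \<in> D \<and> y \<in> D \<and> lab x \<noteq> lab y"
    if xy: "x \<noteq> y" "is_two_matching L" "L \<subseteq> insert {x, y} E"
      and gr: "\<forall>M'. is_two_matching M' \<longrightarrow> M' \<subseteq> E \<longrightarrow> card (\<Union>M') < card (\<Union>L)" for x y L
  proof -
    have "w x + w y < 2"
    proof (rule ccontr)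
      assume *: "\<not> w x + w y < 2"
      have "2 \<le> w u + w v" if "{u, v} \<in> L" for u v
      proof (cases "{u, v} \<in> E")
        case False
        then have "{u, v} = {x, y}" using that xy(3) by blast
        then have "w u + w v = w x + w y" by (auto simp: doubleton_eq_iff)
        then show ?thesis using * by simp
      qed (rule w2)
      moreover have "finite L" using fin xy(3) by (meson finite_insert finite_subset)
      moreover from this have "finite (\<Union>L)" using xy(3) finU
        by (metis Union_insert Union_mono finite.emptyI finite_Un finite_insert finite_subset)
      ultimately have "card (\<Union>L) \<le> card W"
        using card_two_matching_le_weight[OF xy(2), of w] sum_w[of "\<Union>L"] by simp
      then show False using gr K KE WM cardf by fastforce
    qed
    then show ?thesis using xy(1) by (auto simp: D_def lab_def)
  qed
  ultimately show ?thesis unfolding edge_certificate_def by blast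
qed

section \<open>Separating the ends of missing edges\<close>

text \<open>The usual bound for a maximum cut, obtained greedily: each pair containing the new
  element \<open>l\<close> is cut by exactly one of \<open>T\<close> and \<open>insert l T\<close>,
  and the other pairs do not notice the choice.\<close>

lemma ex_cut_half:
  assumes "finite L" "finite Q" "\<And>q. q \<in> Q \<Longrightarrow> a q \<in> L \<and> b q \<in> L \<and> a q \<noteq> b q"
  shows "\<exists>T\<subseteq>L. card Q \<le> 2 * card {q\<in>Q. (a q \<in> T) \<noteq> (b q \<in> T)}"
  using assms
proof (induction L arbitrary: Q rule: finite_induct)
  case empty
  then show ?case by auto
next
  case (insert l L)
  define Q0 where "Q0 = {q\<in>Q. a q \<noteq> l \<and> b q \<noteq> l}"
  define Q1 where "Q1 = {q\<in>Q. a q = l \<or> b q = l}"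
  define cut where "cut P T = {q\<in>P. (a q \<in> T) \<noteq> (b q \<in> T)}" for P T
  have fin: "finite Q0" "finite Q1" using insert.prems(1) by (auto simp: Q0_def Q1_def)
  have "\<exists>T\<subseteq>L. card Q0 \<le> 2 * card {q\<in>Q0. (a q \<in> T) \<noteq> (b q \<in> T)}"
    using fin(1) insert.prems(2) by (intro insert.IH) (auto simp: Q0_def)
  then obtain T where T: "T \<subseteq> L" "card Q0 \<le> 2 * card (cut Q0 T)" by (auto simp: cut_def)
  have lT: "l \<notin> T" using T insert.hyps by auto
  have "Q = Q0 \<union> Q1" "Q0 \<inter> Q1 = {}" by (auto simp: Q0_def Q1_def)
  then have cardQ: "card Q = card Q0 + card Q1" using fin by (simp add: card_Un_disjoint)
  have cut_split: "card (cut Q S) = card (cut Q0 S) + card (cut Q1 S)" for S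
  proof -
    have "cut Q S = cut Q0 S \<union> cut Q1 S" "cut Q0 S \<inter> cut Q1 S = {}"
      by (auto simp: cut_def Q0_def Q1_def)
    then show ?thesis using fin by (simp add: card_Un_disjoint cut_def)
  qed
  have same: "cut Q0 (insert l T) = cut Q0 T" by (auto simp: cut_def Q0_def)
  have "Q1 \<subseteq> cut Q1 T \<union> cut Q1 (insert l T)"
  proof
    fix q assume q: "q \<in> Q1"
    then have "a q \<noteq> b q" using insert.prems(2) by (simp add: Q1_def)
    then show "q \<in> cut Q1 T \<union> cut Q1 (insert l T)" using q lT by (auto simp: cut_def Q1_def)
  qed
  then have "card Q1 \<le> card (cut Q1 T \<union> cut Q1 (insert l T))"
    using fin by (intro card_mono) (auto simp: cut_def)
  also have "\<dots> \<le> card (cut Q1 T) + card (cut Q1 (insert l T))" by (rule card_Un_le)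
  finally have "card Q \<le> 2 * card (cut Q T) \<or> card Q \<le> 2 * card (cut Q (insert l T))"
    using T(2) cardQ cut_split[of T] cut_split[of "insert l T", unfolded same] by arith
  moreover have "T \<subseteq> insert l L" "insert l T \<subseteq> insert l L" using T(1) by auto
  ultimately show ?case unfolding cut_def by blast
qed

text \<open>Passing from \<open>T\<close> to its complement reverses the direction of every cut
  pair, so one of the two sets has at least half of the cut pairs in the right direction.\<close>

lemma ex_directed_cut_quarter:
  assumes "finite Q" "\<And>q. q \<in> Q \<Longrightarrow> a q \<noteq> b q"
  shows "\<exists>T. card Q \<le> 4 * card {q\<in>Q. a q \<in> T \<and> b q \<notin> T}"
proof -
  obtain T where T: "card Q \<le> 2 * card {q\<in>Q. (a q \<in> T) \<noteq> (b q \<in> T)}"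
    using ex_cut_half[of "a ` Q \<union> b ` Q" Q a b] assms by auto
  have "{q\<in>Q. (a q \<in> T) \<noteq> (b q \<in> T)} = {q\<in>Q. a q \<in> T \<and> b q \<notin> T} \<union> {q\<in>Q. a q \<in> - T \<and> b q \<notin> - T}"
    by auto
  then have "card {q\<in>Q. (a q \<in> T) \<noteq> (b q \<in> T)}
      \<le> card {q\<in>Q. a q \<in> T \<and> b q \<notin> T} + card {q\<in>Q. a q \<in> - T \<and> b q \<notin> - T}"
    by (simp only: card_Un_le)
  then have "card Q \<le> 4 * card {q\<in>Q. a q \<in> T \<and> b q \<notin> T} \<or>
      card Q \<le> 4 * card {q\<in>Q. a q \<in> - T \<and> b q \<notin> - T}"
    using T by arith
  then show ?thesis by blast
qed

text \<open>Pairs stand for missing edges with a chosen orientation. Edges among first entries alone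
  or among second entries alone are harmless, which makes it possible to keep a constant
  proportion.\<close>

definition separable :: "nat \<Rightarrow> 'v set set \<Rightarrow> ('v \<times> 'v) set \<Rightarrow> bool" where
  "separable m E Q \<longleftrightarrow>
     (\<exists>Q'\<subseteq>Q. card Q \<le> m * card Q' \<and> (\<forall>p\<in>Q'. \<forall>q\<in>Q'. {fst p, snd q} \<notin> E))"

text \<open>Only the larger of the two subfamilies is kept, so no condition arises between them and
  the factors add up.\<close>

lemma separable_Un:
  assumes "separable m E P" "separable m' E Q"
  shows "separable (m + m') E (P \<union> Q)"
proof -
  obtain P' where P': "P' \<subseteq> P" "card P \<le> m * card P'" "\<forall>p\<in>P'. \<forall>q\<in>P'. {fst p, snd q} \<notin> E"
    using assms(1) unfolding separable_def by blast
  obtain Q' where Q': "Q' \<subseteq> Q" "card Q \<le> m' * card Q'" "\<forall>p\<in>Q'. \<forall>q\<in>Q'. {fst p, snd q} \<notin> E"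
    using assms(2) unfolding separable_def by blast
  define R where "R = (if card P' \<le> card Q' then Q' else P')"
  have "card P' \<le> card R" "card Q' \<le> card R" by (auto simp: R_def)
  then have "m * card P' + m' * card Q' \<le> (m + m') * card R"
    by (simp add: add_mult_distrib add_mono)
  moreover have "card (P \<union> Q) \<le> card P + card Q" by (rule card_Un_le)
  ultimately have "card (P \<union> Q) \<le> (m + m') * card R" using P'(2) Q'(2) by linarith
  moreover have "R \<subseteq> P \<union> Q" "\<forall>p\<in>R. \<forall>q\<in>R. {fst p, snd q} \<notin> E"
    using P' Q' by (auto simp: R_def)
  ultimately show ?thesis unfolding separable_def by blast
qed

lemma separable_if_no_edges:
  assumes "\<And>p q. p \<in> Q \<Longrightarrow> q \<in> Q \<Longrightarrow> {fst p, snd q} \<notin> E"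
  shows "separable 1 E Q"
  unfolding separable_def using assms by (intro exI[of _ Q]) auto

text \<open>A directed cut \<open>T\<close> of the labels keeps the pairs whose first label is in
  \<open>T\<close> and whose second label is not. An edge from a first to a second entry would join
  equal labels.\<close>

lemma separable_if_labels_differ:
  assumes "finite Q" "\<And>x y. (x, y) \<in> Q \<Longrightarrow> lab x \<noteq> lab y"
    "\<And>p q. p \<in> Q \<Longrightarrow> q \<in> Q \<Longrightarrow> {fst p, snd q} \<in> E \<Longrightarrow> lab (fst p) = lab (snd q)"
  shows "separable 4 E Q"
proof -
  obtain T where "card Q \<le> 4 * card {q\<in>Q. lab (fst q) \<in> T \<and> lab (snd q) \<notin> T}"
    using ex_directed_cut_quarter[OF assms(1), of "\<lambda>q. lab (fst q)" "\<lambda>q. lab (snd q)"] assms(2)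
    by fastforce
  then show ?thesis unfolding separable_def
    using assms(3) by (intro exI[of _ "{q\<in>Q. lab (fst q) \<in> T \<and> lab (snd q) \<notin> T}"]) fastforce
qed

lemma ex_edge_certificate:
  assumes "mt = is_matching \<or> mt = is_two_matching" "finite E" "\<forall>e\<in>E. card e = 2"
  shows "\<exists>D lab. edge_certificate mt E D lab"
  using assms ex_edge_certificate_matching ex_edge_certificate_two_matching by blast

text \<open>The three types of pairs are those between different components, those whose addition
  destroys bipartiteness, and those whose addition enlarges a matching. Their factors are 4, 2 and
  4.\<close>

lemma separable_unaddable:
  assumes mt: "mt = is_matching \<or> mt = is_two_matching"
    and E: "finite E" "\<forall>e\<in>E. card e = 2" and Q: "finite Q"
    and bad: "\<And>x y. (x, y) \<in> Q \<Longrightarrow> comp_of E x = comp_of E y \<Longrightarrow> x \<noteq> y \<and>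
      (bipartite_on E (comp_of E x) \<and> \<not> bipartite_on (insert {x, y} E) (comp_of E x) \<or>
       (\<exists>t. has_matching_in mt (insert {x, y} E) (comp_of E x) t \<and> \<not> has_matching_in mt E (comp_of E x) t))"
  shows "separable 10 E Q"
proof -
  define Q1 where "Q1 = {(x, y)\<in>Q. comp_of E x \<noteq> comp_of E y}"
  define Q2 where "Q2 = {(x, y)\<in>Q. comp_of E x = comp_of E y \<and>
    bipartite_on E (comp_of E x) \<and> \<not> bipartite_on (insert {x, y} E) (comp_of E x)}"
  define Q3 where "Q3 = {(x, y)\<in>Q. comp_of E x = comp_of E y \<and> x \<noteq> y \<and>
    (\<exists>t. has_matching_in mt (insert {x, y} E) (comp_of E x) t \<and> \<not> has_matching_in mt E (comp_of E x) t)}"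
  have "p \<in> (Q1 \<union> Q2) \<union> Q3" if p: "p \<in> Q" for p
  proof (cases p)
    case (Pair x y)
    then show ?thesis using p bad[of x y]
      by (cases "comp_of E x = comp_of E y") (simp_all add: Q1_def Q2_def Q3_def)
  qed
  then have Q_eq: "Q = (Q1 \<union> Q2) \<union> Q3" by (auto simp: Q1_def Q2_def Q3_def)
  have fin: "finite Q1" "finite Q3" using Q Q_eq by (metis finite_Un)+
  have "separable 4 E Q1"
  proof (rule separable_if_labels_differ[OF fin(1), of "comp_of E"])
    show "comp_of E x \<noteq> comp_of E y" if "(x, y) \<in> Q1" for x y using that by (simp add: Q1_def)
  qed (rule comp_of_edge)
  moreover have "separable 2 E Q2"
  proof -
    \<comment> \<open>One bipartition of each bipartite component is fixed by choice;
      \<open>A\<close> and \<open>B\<close> collect the first and second sides over all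
      components.\<close>
    define part where "part C X \<longleftrightarrow> fst X \<union> snd X = C \<and> fst X \<inter> snd X = {} \<and>
      (\<forall>e\<in>E. e \<subseteq> C \<longrightarrow> (\<exists>a\<in>fst X. \<exists>b\<in>snd X. e = {a, b}))" for C and X :: "'a set \<times> 'a set"
    define X where "X C = (SOME X. part C X)" for C
    have X: "part C (X C)" if "bipartite_on E C" for C
    proof -
      have "\<exists>X. part C X" using that unfolding bipartite_on_def part_def by simp
      then show ?thesis unfolding X_def by (rule someI_ex)
    qed
    define A where "A = {x. x \<in> fst (X (comp_of E x))}"
    define B where "B = {x. x \<in> snd (X (comp_of E x))}"
    have side: "x \<in> A \<and> y \<in> A \<or> x \<in> B \<and> y \<in> B" if "(x, y) \<in> Q2" for x y
    proof -
      define C where "C = comp_of E x"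
      have C: "comp_of E y = C" "bipartite_on E C" "\<not> bipartite_on (insert {x, y} E) C"
        using that by (auto simp: Q2_def C_def)
      have XC: "part C (X C)" using X[OF C(2)] .
      have "x \<in> C" "y \<in> C" using comp_of_self[of x E] comp_of_self[of y E] C(1) by (auto simp: C_def)
      then have xy: "x \<in> fst (X C) \<union> snd (X C)" "y \<in> fst (X C) \<union> snd (X C)"
        using XC by (auto simp: part_def)
      \<comment> \<open>Were the ends on opposite sides, the same bipartition would remain valid
        after adding the edge.\<close>
      have "\<not> (\<exists>a\<in>fst (X C). \<exists>b\<in>snd (X C). {x, y} = {a, b})"
      proof
        assume "\<exists>a\<in>fst (X C). \<exists>b\<in>snd (X C). {x, y} = {a, b}"
        then have "bipartite_on (insert {x, y} E) C"
          using XC unfolding part_def bipartite_on_def by (intro exI[of _ "fst (X C)"] exI[of _ "snd (X C)"]) simp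
        then show False using C(3) by simp
      qed
      then show ?thesis using xy C(1) by (auto simp: A_def B_def C_def[symmetric] insert_commute)
    qed
    have edge: "\<not> (u \<in> A \<and> v \<in> A) \<and> \<not> (u \<in> B \<and> v \<in> B)"
      if "{u, v} \<in> E" "bipartite_on E (comp_of E u)" for u v
    proof -
      have C: "comp_of E v = comp_of E u" using comp_of_edge[OF that(1)] by simp
      have P: "part (comp_of E u) (X (comp_of E u))" using X[OF that(2)] .
      have sub: "{u, v} \<subseteq> comp_of E u" using C comp_of_self[of u E] comp_of_self[of v E] by auto
      have "\<forall>e\<in>E. e \<subseteq> comp_of E u \<longrightarrow>
          (\<exists>a\<in>fst (X (comp_of E u)). \<exists>b\<in>snd (X (comp_of E u)). e = {a, b})"
        using P unfolding part_def by (elim conjE)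
      from this[rule_format, OF that(1) sub]
      obtain a b where "a \<in> fst (X (comp_of E u))" "b \<in> snd (X (comp_of E u))" "{u, v} = {a, b}"
        by (elim bexE)
      moreover have "fst (X (comp_of E u)) \<inter> snd (X (comp_of E u)) = {}" using P by (simp add: part_def)
      ultimately show ?thesis using C by (auto simp: A_def B_def doubleton_eq_iff)
    qed
    have bip: "bipartite_on E (comp_of E (fst p))" if "p \<in> Q2" for p using that by (auto simp: Q2_def)
    have "Q2 = {p\<in>Q2. fst p \<in> A \<and> snd p \<in> A} \<union> {p\<in>Q2. fst p \<in> B \<and> snd p \<in> B}"
      using side by force
    \<comment> \<open>No edge of a bipartite component joins two vertices of one side, so the pairs
      inside \<open>A\<close> and the pairs inside \<open>B\<close> are each separated without
      loss.\<close>
    moreover have "separable (1 + 1) E ({p\<in>Q2. fst p \<in> A \<and> snd p \<in> A} \<union> {p\<in>Q2. fst p \<in> B \<and> snd p \<in> B})"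
      by (intro separable_Un separable_if_no_edges) (use edge bip in blast)+
    ultimately show ?thesis by (simp add: numeral_2_eq_2)
  qed
  moreover have "separable 4 E Q3"
  proof -
    \<comment> \<open>A certificate is taken for each component separately, because
      \<open>has_matching_in\<close> looks at matchings inside one component. The component is
      recorded in \<open>lab\<close>, next to the label from its certificate.\<close>
    define sub where "sub C = {e\<in>E. e \<subseteq> C}" for C
    have "\<exists>X. edge_certificate mt (sub C) (fst X) (snd X)" for C
      using ex_edge_certificate[OF mt, of "sub C"] E by (auto simp: sub_def)
    then obtain X where X: "\<And>C. edge_certificate mt (sub C) (fst (X C)) (snd (X C))" by metis
    define lab where "lab x = (comp_of E x, snd (X (comp_of E x)) x)" for x
    have Q3: "x \<in> fst (X (comp_of E x)) \<and> y \<in> fst (X (comp_of E y)) \<and> lab x \<noteq> lab y"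
      if xy: "(x, y) \<in> Q3" for x y
    proof -
      define C where "C = comp_of E x"
      obtain t where C: "comp_of E y = C" "x \<noteq> y" and t: "has_matching_in mt (insert {x, y} E) C t"
        "\<not> has_matching_in mt E C t"
        using xy by (auto simp: Q3_def C_def)
      obtain M where M: "mt M" "M \<subseteq> insert {x, y} E" "\<Union>M \<subseteq> C" "t \<le> real (card (\<Union>M))"
        using t(1) unfolding has_matching_in_def by blast
      have "M \<subseteq> insert {x, y} (sub C)" using M(2,3) by (auto simp: sub_def)
      moreover have "card (\<Union>M') < card (\<Union>M)" if "mt M'" "M' \<subseteq> sub C" for M'
      proof -
        have "M' \<subseteq> E" "\<Union>M' \<subseteq> C" using that(2) by (auto simp: sub_def)
        then have "\<not> t \<le> real (card (\<Union>M'))" using t(2) that(1) unfolding has_matching_in_def by blast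
        then show ?thesis using M(4) by linarith
      qed
      ultimately have "x \<in> fst (X C) \<and> y \<in> fst (X C) \<and> snd (X C) x \<noteq> snd (X C) y"
        using X[of C] M(1) C(2) unfolding edge_certificate_def by blast
      then show ?thesis using C(1) by (simp add: lab_def C_def[symmetric])
    qed
    show ?thesis
    proof (rule separable_if_labels_differ[OF fin(2), of lab])
      show "lab x \<noteq> lab y" if "(x, y) \<in> Q3" for x y using Q3[OF that] by simp
      fix p q assume pq: "p \<in> Q3" "q \<in> Q3" "{fst p, snd q} \<in> E"
      define C where "C = comp_of E (fst p)"
      have C: "comp_of E (snd q) = C" using comp_of_edge[OF pq(3)] by (simp add: C_def)
      have "fst p \<in> C" "snd q \<in> C"
        using comp_of_self[of "fst p" E] comp_of_self[of "snd q" E] C by (auto simp: C_def)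
      then have "{fst p, snd q} \<in> sub C" using pq(3) by (simp add: sub_def)
      moreover have "fst p \<in> fst (X C)" using Q3[of "fst p" "snd p"] pq(1) by (simp add: C_def)
      moreover have "snd q \<in> fst (X C)" using Q3[of "fst q" "snd q"] pq(2) C by simp
      ultimately have "snd (X C) (fst p) = snd (X C) (snd q)"
        using X[of C] unfolding edge_certificate_def by blast
      then show "lab (fst p) = lab (snd q)" using C by (simp add: lab_def C_def)
    qed
  qed
  ultimately have "separable ((4 + 2) + 4) E ((Q1 \<union> Q2) \<union> Q3)" by (intro separable_Un)
  then show ?thesis using Q_eq by simp
qed

section \<open>The colouring condition under deletion and addition of edges\<close>

text \<open>The two ranges of colours are merged: a large matching is tolerated only in a bipartite
  component of a colour above \<open>k0\<close>.\<close>

lemma no_large_connected_matchings_iff: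
  assumes "k0 \<le> k"
  shows "no_large_connected_matchings mt k0 k t E c \<longleftrightarrow>
    (\<forall>l\<in>{1..k}. \<forall>x\<in>\<Union>(colour_class E c l).
       has_matching_in mt (colour_class E c l) (comp_of (colour_class E c l) x) (t l) \<longrightarrow>
       k0 < l \<and> bipartite_on (colour_class E c l) (comp_of (colour_class E c l) x))"
    (is "_ \<longleftrightarrow> (\<forall>l\<in>{1..k}. ?P l)")
proof -
  have "no_large_connected_matchings mt k0 k t E c \<longleftrightarrow> (\<forall>l\<in>{1..k0}. ?P l) \<and> (\<forall>l\<in>{k0+1..k}. ?P l)"
    unfolding no_large_connected_matchings_def graph_components_eq by fastforce
  moreover have "{1..k} = {1..k0} \<union> {k0+1..k}" using assms by auto
  ultimately show ?thesis by (simp add: ball_Un)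
qed

lemma comp_of_mono: "E \<subseteq> E' \<Longrightarrow> comp_of E x \<subseteq> comp_of E' x"
  by (rule comp_of_subset) (auto intro: comp_of_self comp_of_step)

lemma has_matching_in_mono:
  "has_matching_in mt E C t \<Longrightarrow> E \<subseteq> E' \<Longrightarrow> C \<subseteq> C' \<Longrightarrow> has_matching_in mt E' C' t"
  unfolding has_matching_in_def by (meson order_trans)

lemma bipartite_on_mono:
  assumes "bipartite_on E' C'" "E \<subseteq> E'" "C \<subseteq> C'"
  shows "bipartite_on E C"
proof -
  obtain A B where AB: "A \<union> B = C'" "A \<inter> B = {}" "\<forall>e\<in>E'. e \<subseteq> C' \<longrightarrow> (\<exists>a\<in>A. \<exists>b\<in>B. e = {a, b})"
    using assms(1) unfolding bipartite_on_def by (elim exE conjE)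
  have "\<exists>a\<in>A \<inter> C. \<exists>b\<in>B \<inter> C. e = {a, b}" if "e \<in> E" "e \<subseteq> C" for e
  proof -
    have "e \<in> E'" "e \<subseteq> C'" using that assms(2,3) by auto
    then obtain a b where "a \<in> A" "b \<in> B" "e = {a, b}" using AB(3) by meson
    then show ?thesis using that(2) by blast
  qed
  moreover have "(A \<inter> C) \<union> (B \<inter> C) = C" "(A \<inter> C) \<inter> (B \<inter> C) = {}" using AB(1,2) assms(3) by auto
  ultimately show ?thesis unfolding bipartite_on_def by meson
qed

text \<open>A large matching survives in the possibly larger component of \<open>E'\<close>, which
  must then be bipartite of a colour above \<open>k0\<close>, and bipartiteness is inherited by
  subgraphs.\<close>

lemma no_large_connected_matchings_subset:
  assumes "k0 \<le> k" "no_large_connected_matchings mt k0 k t E' c" "E \<subseteq> E'"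
  shows "no_large_connected_matchings mt k0 k t E c"
  unfolding no_large_connected_matchings_iff[OF assms(1)]
proof (intro ballI impI)
  fix l x
  let ?H = "colour_class E c l" and ?H' = "colour_class E' c l"
  assume l: "l \<in> {1..k}" and x: "x \<in> \<Union>?H" and has: "has_matching_in mt ?H (comp_of ?H x) (t l)"
  have sub: "?H \<subseteq> ?H'" using assms(3) by (auto simp: colour_class_def)
  then have sub': "comp_of ?H x \<subseteq> comp_of ?H' x" by (rule comp_of_mono)
  have "k0 < l \<and> bipartite_on ?H' (comp_of ?H' x)"
    using assms(2) l x sub has_matching_in_mono[OF has sub sub']
    unfolding no_large_connected_matchings_iff[OF assms(1)] by blast
  then show "k0 < l \<and> bipartite_on ?H (comp_of ?H x)" using bipartite_on_mono[OF _ sub sub'] by blast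
qed

text \<open>Only colour \<open>l\<close> changes, and since \<open>x\<close> and \<open>y\<close>
  are already connected in it, no component changes its vertex set. The violation sits in the
  component of \<open>x\<close>, where the new edge either creates the large matching or destroys
  bipartiteness.\<close>

lemma unaddable_edge:
  assumes k: "k0 \<le> k" and E: "no_large_connected_matchings mt k0 k t E c"
    and xy: "x \<noteq> y" "{x, y} \<notin> E"
    and E': "\<not> no_large_connected_matchings mt k0 k t (insert {x, y} E) (c({x, y} := l))"
    and H: "H = colour_class E c l" and C: "comp_of H x = comp_of H y"
  shows "bipartite_on H (comp_of H x) \<and> \<not> bipartite_on (insert {x, y} H) (comp_of H x) \<or>
    has_matching_in mt (insert {x, y} H) (comp_of H x) (t l) \<and> \<not> has_matching_in mt H (comp_of H x) (t l)"
proof -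
  let ?E = "insert {x, y} E" and ?c = "c({x, y} := l)"
  have same: "colour_class ?E ?c l' = colour_class E c l'" if "l' \<noteq> l" for l'
    using that xy(2) by (auto simp: colour_class_def)
  have new: "colour_class ?E ?c l = insert {x, y} H"
    using xy(2) by (auto simp: colour_class_def H)
  obtain l' z where l': "l' \<in> {1..k}" and z: "z \<in> \<Union>(colour_class ?E ?c l')"
    and bad: "has_matching_in mt (colour_class ?E ?c l') (comp_of (colour_class ?E ?c l') z) (t l')"
      "\<not> (k0 < l' \<and> bipartite_on (colour_class ?E ?c l') (comp_of (colour_class ?E ?c l') z))"
    using E' unfolding no_large_connected_matchings_iff[OF k] by blast
  have "l' = l"
  proof (rule ccontr)
    assume "l' \<noteq> l"
    then show False using E l' z bad same unfolding no_large_connected_matchings_iff[OF k] by metis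
  qed
  have comp: "comp_of (insert {x, y} H) u = comp_of H u" for u
  proof
    show "comp_of (insert {x, y} H) u \<subseteq> comp_of H u"
    proof (rule comp_of_subset)
      fix v w assume v: "v \<in> comp_of H u" and "{v, w} \<in> insert {x, y} H"
      then consider "{v, w} \<in> H" | "{v, w} = {x, y}" by blast
      then show "w \<in> comp_of H u"
      proof cases
        case 1
        then show ?thesis using v comp_of_step by metis
      next
        case 2
        then have "comp_of H v = comp_of H w" using C by (auto simp: doubleton_eq_iff)
        then show ?thesis using comp_of_eq[OF v] comp_of_self by metis
      qed
    qed (rule comp_of_self)
    show "comp_of H u \<subseteq> comp_of (insert {x, y} H) u" by (rule comp_of_mono) auto
  qed
  \<comment> \<open>A vertex on no edge of \<open>H\<close> is a component by itself, unlike two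
    distinct connected vertices. Hence the new edge covers no new vertex, and the assumption on
    \<open>E\<close> applies to \<open>z\<close>.\<close>
  have xyH: "{x, y} \<subseteq> \<Union>H"
  proof (rule ccontr)
    assume "\<not> {x, y} \<subseteq> \<Union>H"
    then obtain u v where uv: "{u, v} = {x, y}" "u \<notin> \<Union>H" by auto
    have "comp_of H u \<subseteq> {u}" by (rule comp_of_subset) (use uv(2) in auto)
    moreover have "v \<in> comp_of H u" using C uv(1) comp_of_self[of v H] by (auto simp: doubleton_eq_iff)
    ultimately have "u = v" by blast
    then show False using uv(1) xy(1) by (metis doubleton_eq_iff)
  qed
  have zH: "z \<in> \<Union>H" using z xyH unfolding \<open>l' = l\<close> new by auto
  have has: "has_matching_in mt (insert {x, y} H) (comp_of H z) (t l)"
    and nbip: "\<not> (k0 < l \<and> bipartite_on (insert {x, y} H) (comp_of H z))"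
    using bad unfolding \<open>l' = l\<close> new comp by auto
  have old: "has_matching_in mt H (comp_of H z) (t l) \<longrightarrow> k0 < l \<and> bipartite_on H (comp_of H z)"
    using E l' zH unfolding no_large_connected_matchings_iff[OF k] \<open>l' = l\<close> H by blast
  \<comment> \<open>In a component avoiding \<open>x\<close>, the new edge affects neither matchings
    nor bipartitions.\<close>
  have "comp_of H z = comp_of H x"
  proof (rule ccontr)
    assume "comp_of H z \<noteq> comp_of H x"
    then have xz: "x \<notin> comp_of H z" using comp_of_eq by metis
    have "has_matching_in mt H (comp_of H z) (t l)"
      using has xz unfolding has_matching_in_def by blast
    moreover have "bipartite_on H (comp_of H z) \<Longrightarrow> bipartite_on (insert {x, y} H) (comp_of H z)"
      using xz unfolding bipartite_on_def by auto
    ultimately show False using old nbip by blast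
  qed
  then show ?thesis using has nbip old by auto
qed

section \<open>Iteration over the colours, pigeonhole, maximal matchings\<close>

text \<open>Each colour in turn costs a factor \<open>m\<close>. The hypothesis ranges over all
  subfamilies because it is applied to what survived the earlier colours, whose separation is
  inherited.\<close>

lemma ex_separated_all_colours:
  assumes "finite Q" "\<And>l Q'. l \<in> {1..k} \<Longrightarrow> Q' \<subseteq> Q \<Longrightarrow> separable m (E l) Q'"
  shows "\<exists>Q'\<subseteq>Q. card Q \<le> m ^ k * card Q' \<and> (\<forall>l\<in>{1..k}. \<forall>p\<in>Q'. \<forall>q\<in>Q'. {fst p, snd q} \<notin> E l)"
  using assms(2)
proof (induction k)
  case 0
  then show ?case by (intro exI[of _ Q]) auto
next
  case (Suc k)
  then have "\<exists>Q'\<subseteq>Q. card Q \<le> m ^ k * card Q' \<and> (\<forall>l\<in>{1..k}. \<forall>p\<in>Q'. \<forall>q\<in>Q'. {fst p, snd q} \<notin> E l)"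
    by simp
  then obtain Q' where Q': "Q' \<subseteq> Q" "card Q \<le> m ^ k * card Q'"
    "\<forall>l\<in>{1..k}. \<forall>p\<in>Q'. \<forall>q\<in>Q'. {fst p, snd q} \<notin> E l" by blast
  have "separable m (E (Suc k)) Q'" using Suc.prems[of "Suc k" Q'] Q'(1) by simp
  then obtain Q'' where Q'': "Q'' \<subseteq> Q'" "card Q' \<le> m * card Q''"
    "\<forall>p\<in>Q''. \<forall>q\<in>Q''. {fst p, snd q} \<notin> E (Suc k)" unfolding separable_def by blast
  have "m ^ k * card Q' \<le> m ^ k * (m * card Q'')" using Q''(2) by (rule mult_le_mono2)
  also have "\<dots> = m ^ Suc k * card Q''" by simp
  finally have "card Q \<le> m ^ Suc k * card Q''" using Q'(2) by (rule order_trans[rotated])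
  moreover have "\<forall>l\<in>{1..Suc k}. \<forall>p\<in>Q''. \<forall>q\<in>Q''. {fst p, snd q} \<notin> E l"
  proof
    fix l assume "l \<in> {1..Suc k}"
    then consider "l \<in> {1..k}" | "l = Suc k" by (auto simp: le_Suc_eq)
    then show "\<forall>p\<in>Q''. \<forall>q\<in>Q''. {fst p, snd q} \<notin> E l"
      by cases (use Q'(3) Q''(1) in blast, use Q''(3) in blast)
  qed
  ultimately show ?case using order_trans[OF Q''(1) Q'(1)] by (intro exI[of _ Q''] conjI)
qed

lemma ex_large_fibre:
  assumes "finite A" "finite B" "B \<noteq> {}" "\<And>a. a \<in> A \<Longrightarrow> g a \<in> B"
  shows "\<exists>b\<in>B. card A \<le> card B * card {a\<in>A. g a = b}"
proof (rule ccontr)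
  assume "\<not> ?thesis"
  then have "(\<Sum>b\<in>B. card B * card {a\<in>A. g a = b}) < (\<Sum>b\<in>B. card A)"
    using assms(2,3) by (intro sum_strict_mono) auto
  moreover have "(\<Sum>b\<in>B. card {a\<in>A. g a = b}) = card A"
    using sum.group[OF assms(1,2), of g "\<lambda>_. 1 :: nat"] assms(4) by (simp add: image_subset_iff)
  ultimately show False by (simp flip: sum_distrib_left)
qed

text \<open>This turns a bound on matchings of missing edges into a small vertex cover of all
  missing edges.\<close>

lemma ex_maximal_matching:
  assumes "finite E" "\<forall>e\<in>E. card e = 2"
  shows "\<exists>W. is_matching W \<and> W \<subseteq> E \<and> (\<forall>e\<in>E. e \<inter> \<Union>W \<noteq> {})"
proof -
  obtain W where W: "max_matching E W" using ex_max_matching[OF assms(1)] by blast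
  have "e \<inter> \<Union>W \<noteq> {}" if e: "e \<in> E" for e
  proof -
    obtain u v where "u \<noteq> v" "e = {u, v}" using assms(2) e by (metis card_2_iff)
    then show ?thesis using max_matching_covers_edge[OF assms(1) _ _ W, of u v] e by auto
  qed
  then show ?thesis using W by (auto simp: max_matching_def)
qed

section \<open>Completing a blow-up\<close>

lemma blow_up_edges_finite:
  assumes "loop_graph_on {1..s} F" "\<forall>i\<in>{1..s}. finite (V i)"
  shows "finite (blow_up_edges F V)"
proof -
  have "blow_up_edges F V \<subseteq> Pow (\<Union>i\<in>{1..s}. V i)"
  proof
    fix e assume "e \<in> blow_up_edges F V"
    then obtain x y i j where e: "{i, j} \<in> F" "x \<in> V i" "y \<in> V j" "e = {x, y}"
      unfolding blow_up_edges_def by blast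
    then have "i \<in> {1..s} \<and> j \<in> {1..s}"
      using assms(1) unfolding loop_graph_on_def by (metis doubleton_eq_iff)
    then show "e \<in> Pow (\<Union>i\<in>{1..s}. V i)" using e by auto
  qed
  then show ?thesis using assms(2) by (meson finite_Pow_iff finite_UN_I finite_atLeastAtMost finite_subset)
qed

lemma blow_up_edgesE:
  assumes "e \<in> blow_up_edges F V"
  obtains x y i j where "{i, j} \<in> F" "x \<in> V i" "y \<in> V j" "x \<noteq> y" "e = {x, y}"
  using assms unfolding blow_up_edges_def by blast

lemma blow_up_edgesI:
  "{i, j} \<in> F \<Longrightarrow> x \<in> V i \<Longrightarrow> y \<in> V j \<Longrightarrow> x \<noteq> y \<Longrightarrow> {x, y} \<in> blow_up_edges F V"
  unfolding blow_up_edges_def by blast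

lemma loop_graph_onD:
  assumes "loop_graph_on X F" "{i, j} \<in> F"
  shows "i \<in> X" "j \<in> X"
  using assms unfolding loop_graph_on_def by (metis doubleton_eq_iff)+

lemma vertex_degree_diff:
  assumes "finite E" "E' \<subseteq> E"
  shows "card {e\<in>E - E'. u \<in> e} + vertex_degree E' u = vertex_degree E u"
proof -
  have "{e\<in>E. u \<in> e} = {e\<in>E - E'. u \<in> e} \<union> {e\<in>E'. u \<in> e}" using assms(2) by auto
  moreover have "{e\<in>E - E'. u \<in> e} \<inter> {e\<in>E'. u \<in> e} = {}" by auto
  moreover have "finite E'" using assms by (rule finite_subset[rotated])
  ultimately show ?thesis using assms(1) by (simp add: vertex_degree_def card_Un_disjoint)
qed

lemma vertex_degree_mono: "finite E \<Longrightarrow> E' \<subseteq> E \<Longrightarrow> vertex_degree E' u \<le> vertex_degree E u"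
  unfolding vertex_degree_def by (intro card_mono) auto

text \<open>Among the admissible pairs of an edge set and a colouring, one with the most edges is
  taken. An edge that is added lies outside \<open>EG\<close>, so the given colours never
  change.\<close>

lemma ex_edge_maximal_extension:
  assumes "finite EB" "EG \<subseteq> EB" "c \<in> EG \<rightarrow> {1..k :: nat}" "P EG c"
  shows "\<exists>E c'. EG \<subseteq> E \<and> E \<subseteq> EB \<and> c' \<in> E \<rightarrow> {1..k} \<and> (\<forall>e\<in>EG. c' e = c e) \<and> P E c' \<and>
    (\<forall>e\<in>EB - E. \<forall>l\<in>{1..k}. \<not> P (insert e E) (c'(e := l)))"
proof -
  define good where "good X \<longleftrightarrow> EG \<subseteq> fst X \<and> fst X \<subseteq> EB \<and> snd X \<in> fst X \<rightarrow> {1..k} \<and>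
    (\<forall>e\<in>EG. snd X e = c e) \<and> P (fst X) (snd X)" for X :: "'a set \<times> ('a \<Rightarrow> nat)"
  have "good (EG, c)" using assms by (simp add: good_def)
  moreover have "\<forall>X. good X \<longrightarrow> card (fst X) < Suc (card EB)"
    using assms(1) by (auto simp: good_def less_Suc_eq_le intro: card_mono)
  ultimately obtain X where X: "good X" "\<And>Y. good Y \<Longrightarrow> card (fst Y) \<le> card (fst X)"
    using ex_has_greatest_nat[of good "(EG, c)" "\<lambda>X. card (fst X)" "Suc (card EB)"] by blast
  have "\<not> P (insert e (fst X)) ((snd X)(e := l))" if e: "e \<in> EB - fst X" and l: "l \<in> {1..k}" for e l
  proof
    assume "P (insert e (fst X)) ((snd X)(e := l))"
    moreover have "e \<notin> EG" using e X(1) by (auto simp: good_def)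
    ultimately have "good (insert e (fst X), (snd X)(e := l))" using X(1) e l by (auto simp: good_def)
    then have "card (insert e (fst X)) \<le> card (fst X)" using X(2) by fastforce
    moreover have "finite (fst X)" using X(1) assms(1) by (auto simp: good_def intro: finite_subset)
    ultimately show False using e by simp
  qed
  then show ?thesis using X(1) unfolding good_def by blast
qed

text \<open>Pigeonhole over the \<open>s ^ 2\<close> ordered pairs of blobs, followed by separation
  in all \<open>k\<close> colours, keeps at least one in \<open>s ^ 2 * 10 ^ k\<close> edges of
  \<open>W\<close>. A single remaining first end then misses all remaining second ends, so at most
  \<open>d\<close> edges remain.\<close>

lemma missing_matching_small:
  assumes mt: "mt = is_matching \<or> mt = is_two_matching" and k: "k0 \<le> k"
    and F: "loop_graph_on {1..s} F" and V: "\<forall>i\<in>{1..s}. finite (V i)"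
    and EB: "EB = blow_up_edges F V"
    and E: "E \<subseteq> EB" "c \<in> E \<rightarrow> {1..k}" "no_large_connected_matchings mt k0 k t E c"
    and maximal: "\<forall>e\<in>EB - E. \<forall>l\<in>{1..k}. \<not> no_large_connected_matchings mt k0 k t (insert e E) (c(e := l))"
    and deg: "\<forall>u\<in>(\<Union>i\<in>{1..s}. V i). real (card {e\<in>EB - E. u \<in> e}) \<le> d"
    and W: "is_matching W" "W \<subseteq> EB - E" "W \<noteq> {}"
  shows "real (card W) \<le> real (s ^ 2 * 10 ^ k) * d"
proof -
  have finEB: "finite EB" unfolding EB by (rule blow_up_edges_finite[OF F V])
  have finW: "finite W" using W(2) finEB by (meson finite_Diff finite_subset)
  have two: "card e = 2" if "e \<in> EB" for e using that unfolding EB by (auto elim: blow_up_edgesE)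
  have "\<forall>e\<in>W. \<exists>X. fst (snd X) \<in> V (fst (fst X)) \<and> snd (snd X) \<in> V (snd (fst X)) \<and>
      {fst (fst X), snd (fst X)} \<in> F \<and> fst (snd X) \<noteq> snd (snd X) \<and> e = {fst (snd X), snd (snd X)}"
  proof
    fix e assume "e \<in> W"
    then have "e \<in> blow_up_edges F V" using W(2) EB by auto
    then obtain x y i j where "{i, j} \<in> F" "x \<in> V i" "y \<in> V j" "x \<noteq> y" "e = {x, y}"
      by (rule blow_up_edgesE)
    then show "\<exists>X. fst (snd X) \<in> V (fst (fst X)) \<and> snd (snd X) \<in> V (snd (fst X)) \<and>
      {fst (fst X), snd (fst X)} \<in> F \<and> fst (snd X) \<noteq> snd (snd X) \<and> e = {fst (snd X), snd (snd X)}"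
      by (intro exI[of _ "((i, j), (x, y))"]) simp
  qed
  \<comment> \<open>\<open>X e\<close> records \<open>((i, j), (x, y))\<close>, the blobs and the
    ends of \<open>e\<close> in an orientation fixed once and for all.\<close>
  from bchoice[OF this] obtain X where X: "\<And>e. e \<in> W \<Longrightarrow> fst (snd (X e)) \<in> V (fst (fst (X e))) \<and>
      snd (snd (X e)) \<in> V (snd (fst (X e))) \<and> {fst (fst (X e)), snd (fst (X e))} \<in> F \<and>
      fst (snd (X e)) \<noteq> snd (snd (X e)) \<and> e = {fst (snd (X e)), snd (snd (X e))}"
    by auto
  have blob: "fst (X e) \<in> {1..s} \<times> {1..s}" if "e \<in> W" for e
    using X[OF that] loop_graph_onD[OF F] by (metis mem_Times_iff)
  then have "{1..s} \<times> {1..s} \<noteq> {}" using W(3) by blast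
  then obtain b where b: "b \<in> {1..s} \<times> {1..s}"
    "card W \<le> card ({1..s} \<times> {1..s}) * card {e\<in>W. fst (X e) = b}"
    using ex_large_fibre[of W "{1..s} \<times> {1..s}" "\<lambda>e. fst (X e)"] finW blob by auto
  define W' where "W' = {e\<in>W. fst (X e) = b}"
  define Q where "Q = (\<lambda>e. snd (X e)) ` W'"
  have "inj_on (\<lambda>e. snd (X e)) W'" using X by (intro inj_onI) (metis (no_types, lifting) W'_def mem_Collect_eq)
  then have cardQ: "card Q = card W'" unfolding Q_def by (rule card_image)
  have finQ: "finite Q" using finW by (simp add: Q_def W'_def)
  have Q: "fst p \<in> V (fst b)" "snd p \<in> V (snd b)" "fst p \<noteq> snd p" "{fst p, snd p} \<in> W"
    "snd (X {fst p, snd p}) = p" if pQ: "p \<in> Q" for p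
  proof -
    obtain e where e: "e \<in> W" "fst (X e) = b" "p = snd (X e)"
      using pQ unfolding Q_def W'_def by blast
    show "fst p \<in> V (fst b)" "snd p \<in> V (snd b)" "fst p \<noteq> snd p" using X[OF e(1)] e(2,3) by auto
    have "e = {fst p, snd p}" using X[OF e(1)] e(3) by simp
    then show "{fst p, snd p} \<in> W" "snd (X {fst p, snd p}) = p" using e by auto
  qed
  have bF: "{fst b, snd b} \<in> F"
  proof -
    have "W' \<noteq> {}"
    proof
      assume "W' = {}"
      then have "card W = 0" using b(2) by (simp add: W'_def[symmetric])
      then show False using W(3) finW by simp
    qed
    then obtain e where "e \<in> W" "fst (X e) = b" by (auto simp: W'_def)
    then show ?thesis using X by blast
  qed
  \<comment> \<open>The two blobs coincide in the case of a loop of \<open>F\<close>, so this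
    distinctness has to come from \<open>W\<close> being a matching. It makes
    \<open>{fst p, snd q}\<close> an edge of the blow-up; the second part makes these edges
    different for different \<open>q\<close>.\<close>
  have Qdisj: "fst p \<noteq> snd q \<and> (snd p = snd q \<longrightarrow> p = q)" if pq: "p \<in> Q" "q \<in> Q" for p q
  proof (cases "{fst p, snd p} = {fst q, snd q}")
    case True
    then have "p = q" using Q(5)[OF pq(1)] Q(5)[OF pq(2)] by metis
    then show ?thesis using Q(3)[OF pq(1)] by simp
  next
    case False
    then show ?thesis using matchingD[OF W(1) Q(4)[OF pq(1)] Q(4)[OF pq(2)]] by auto
  qed
  have sep: "separable 10 (colour_class E c l) Q'" if l: "l \<in> {1..k}" and Q': "Q' \<subseteq> Q" for l Q'
  proof (rule separable_unaddable[OF mt])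
    show "finite (colour_class E c l)" using E(1) finEB
      by (auto simp: colour_class_def intro: finite_subset)
    show "\<forall>e\<in>colour_class E c l. card e = 2" using E(1) two by (auto simp: colour_class_def)
    show "finite Q'" using Q' finQ by (rule finite_subset)
    fix x y assume xy: "(x, y) \<in> Q'"
      and C: "comp_of (colour_class E c l) x = comp_of (colour_class E c l) y"
    have "(x, y) \<in> Q" using xy Q' by auto
    then have "x \<noteq> y" "{x, y} \<in> EB - E" using Q[of "(x, y)"] W(2) by auto
    then show "x \<noteq> y \<and> (bipartite_on (colour_class E c l) (comp_of (colour_class E c l) x) \<and>
        \<not> bipartite_on (insert {x, y} (colour_class E c l)) (comp_of (colour_class E c l) x) \<or>
       (\<exists>t. has_matching_in mt (insert {x, y} (colour_class E c l)) (comp_of (colour_class E c l) x) t \<and>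
         \<not> has_matching_in mt (colour_class E c l) (comp_of (colour_class E c l) x) t))"
      using unaddable_edge[OF k E(3) _ _ _ refl C] maximal l by blast
  qed
  have "\<exists>Q'\<subseteq>Q. card Q \<le> 10 ^ k * card Q' \<and>
      (\<forall>l\<in>{1..k}. \<forall>p\<in>Q'. \<forall>q\<in>Q'. {fst p, snd q} \<notin> colour_class E c l)"
    by (rule ex_separated_all_colours[OF finQ]) (rule sep)
  then obtain Q' where Q': "Q' \<subseteq> Q" "card Q \<le> 10 ^ k * card Q'"
    "\<forall>l\<in>{1..k}. \<forall>p\<in>Q'. \<forall>q\<in>Q'. {fst p, snd q} \<notin> colour_class E c l"
    by (elim exE conjE) (rule that)
  have "card W \<le> s ^ 2 * card Q" using b(2) cardQ by (simp add: W'_def power2_eq_square)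
  also have "\<dots> \<le> s ^ 2 * (10 ^ k * card Q')" using Q'(2) by (rule mult_le_mono2)
  finally have WQ': "card W \<le> s ^ 2 * 10 ^ k * card Q'" by simp
  then have "Q' \<noteq> {}" using W(3) finW by auto
  then obtain p where p: "p \<in> Q'" by blast
  then have pQ: "p \<in> Q" using Q'(1) by auto
  have "inj_on (\<lambda>q. {fst p, snd q}) Q'"
  proof (rule inj_onI)
    fix q r assume qr: "q \<in> Q'" "r \<in> Q'" "{fst p, snd q} = {fst p, snd r}"
    then have "snd q = snd r" by (auto simp: doubleton_eq_iff)
    then show "q = r" using Qdisj[of q r] qr Q'(1) by auto
  qed
  then have "card Q' = card ((\<lambda>q. {fst p, snd q}) ` Q')" by (rule card_image[symmetric])
  also have "\<dots> \<le> card {e\<in>EB - E. fst p \<in> e}"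
  proof (rule card_mono)
    show "finite {e\<in>EB - E. fst p \<in> e}" using finEB by auto
    show "(\<lambda>q. {fst p, snd q}) ` Q' \<subseteq> {e\<in>EB - E. fst p \<in> e}"
    proof
      fix e assume "e \<in> (\<lambda>q. {fst p, snd q}) ` Q'"
      then obtain q where q: "q \<in> Q'" "e = {fst p, snd q}" by auto
      then have qQ: "q \<in> Q" using Q'(1) by auto
      have "e \<in> EB" unfolding q(2) EB
        using blow_up_edgesI[OF bF Q(1)[OF pQ] Q(2)[OF qQ]] Qdisj[OF pQ qQ] by simp
      \<comment> \<open>Every edge of \<open>E\<close> has a colour in \<open>{1..k}\<close>, so a
        pair absent from all these colour classes is missing.\<close>
      moreover have "e \<notin> E"
      proof
        assume e: "e \<in> E"
        then have "c e \<in> {1..k}" using E(2) by auto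
        moreover have "e \<in> colour_class E c (c e)" using e by (simp add: colour_class_def)
        ultimately show False using Q'(3) p q(1) unfolding q(2) by blast
      qed
      ultimately show "e \<in> {e\<in>EB - E. fst p \<in> e}" using q(2) by auto
    qed
  qed
  finally have "real (card Q') \<le> real (card {e\<in>EB - E. fst p \<in> e})" by simp
  moreover have "fst p \<in> (\<Union>i\<in>{1..s}. V i)" using Q(1)[OF pQ] b(1) by auto
  ultimately have "real (card Q') \<le> d" using deg by (meson order_trans)
  then have "real (s ^ 2 * 10 ^ k) * real (card Q') \<le> real (s ^ 2 * 10 ^ k) * d"
    by (intro mult_left_mono) auto
  moreover have "real (card W) \<le> real (s ^ 2 * 10 ^ k) * real (card Q')"
    using WQ' by (metis of_nat_le_iff of_nat_mult)
  ultimately show ?thesis by linarith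
qed

text \<open>In terms of \<open>\<rho>\<close> the left side is \<epsilon> times
  \<open>real s ^ 2 * (10 * \<rho> ^ 2) ^ k\<close>: the loss of 10 in each colour is offset by
  \<open>\<rho> ^ 2\<close>. The leading 2 counts both ends of each matching edge.\<close>

lemma delta_bound:
  fixes \<alpha> \<beta> \<epsilon> :: real
  assumes "0 < s" "0 < k" "0 < \<alpha>" "\<alpha> \<le> \<beta>" "0 < \<epsilon>"
  shows "2 * (real (s ^ 2 * 10 ^ k) * (\<epsilon> / 2 * (\<alpha> / (56 * real s ^ 3 * \<beta>)) ^ (2 * k))) \<le> \<epsilon>"
proof -
  define \<rho> where "\<rho> = \<alpha> / (56 * real s ^ 3 * \<beta>)"
  have s1: "1 \<le> real s" using assms(1) by simp
  have "real s ^ 1 \<le> real s ^ 3" using s1 by (intro power_increasing) auto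
  then have "real s * \<beta> \<le> real s ^ 3 * \<beta>" using assms by (intro mult_right_mono) auto
  moreover have "real s * \<alpha> \<le> real s * \<beta>" using assms s1 by (intro mult_left_mono) auto
  moreover have "0 < real s * \<alpha>" using assms s1 by simp
  ultimately have "10 * real s * \<alpha> \<le> 56 * real s ^ 3 * \<beta>" by linarith
  moreover have pos: "0 < 56 * real s ^ 3 * \<beta>" using assms by simp
  ultimately have rs: "10 * real s * \<rho> \<le> 1" by (simp add: \<rho>_def divide_simps mult_ac)
  have r0: "0 \<le> \<rho>" using assms by (simp add: \<rho>_def)
  have "(10 * real s * \<rho>) ^ 2 \<le> 1" using rs r0 s1 by (intro power_le_one) auto
  then have sq: "100 * (real s ^ 2 * \<rho> ^ 2) \<le> 1" by (simp add: power_mult_distrib mult_ac)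
  have "real s ^ 2 * \<rho> ^ 2 \<ge> \<rho> ^ 2" using s1 by (simp add: mult_le_cancel_right1)
  then have le1: "10 * \<rho> ^ 2 \<le> 1" using sq zero_le_power2[of \<rho>] by linarith
  \<comment> \<open>As \<open>k\<close> is positive and the base is at most 1, the power is at most
    its base, whose \<open>\<rho> ^ 2\<close> absorbs \<open>real s ^ 2\<close>.\<close>
  have "(10 * \<rho> ^ 2) ^ k \<le> (10 * \<rho> ^ 2) ^ 1"
    using le1 assms(2) by (intro power_decreasing) auto
  then have "real s ^ 2 * (10 * \<rho> ^ 2) ^ k \<le> real s ^ 2 * (10 * \<rho> ^ 2)"
    by (intro mult_left_mono) auto
  also have "\<dots> = 10 * (real s ^ 2 * \<rho> ^ 2)" by simp
  also have "\<dots> \<le> 1" using sq mult_nonneg_nonneg[OF zero_le_power2[of "real s"] zero_le_power2[of \<rho>]]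
    by linarith
  finally have main: "real s ^ 2 * (10 * \<rho> ^ 2) ^ k \<le> 1" .
  have pow: "(10 * \<rho> ^ 2) ^ k = 10 ^ k * \<rho> ^ (2 * k)" by (simp only: power_mult_distrib power_mult)
  have "2 * (real (s ^ 2 * 10 ^ k) * (\<epsilon> / 2 * \<rho> ^ (2 * k))) = \<epsilon> * (real s ^ 2 * (10 * \<rho> ^ 2) ^ k)"
    unfolding pow by (simp add: mult_ac)
  also have "\<dots> \<le> \<epsilon>" using mult_left_mono[OF main, of \<epsilon>] assms(5) by simp
  finally show ?thesis unfolding \<rho>_def .
qed

theorem theorem2p2:
  fixes s k0 k :: nat and \<alpha> \<beta> :: real and F :: "nat set set"
    and mt :: "'v set set \<Rightarrow> bool"
  assumes "mt = is_matching \<or> mt = is_two_matching"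
    and "0 < s" and "0 < k0" and "k0 \<le> k"
    and "0 < \<alpha>" and "\<alpha> \<le> \<beta>"
    and "loop_graph_on {1..s} F"
  shows "\<exists>\<epsilon>0>0. \<forall>\<epsilon> \<delta> n :: real. \<forall>(N :: nat \<Rightarrow> nat) (\<alpha>s :: nat \<Rightarrow> real)
           (V :: nat \<Rightarrow> 'v set) (EB :: 'v set set) (EG :: 'v set set) (c :: 'v set \<Rightarrow> nat).
         0 < \<epsilon> \<and> \<epsilon> \<le> \<epsilon>0 \<and>
         \<delta> = \<epsilon> / 2 * (\<alpha> / (56 * real s ^ 3 * \<beta>)) ^ (2 * k) \<and>
         0 < n \<and>
         (\<forall>i\<in>{1..s}. 0 < N i \<and> real (N i) \<le> \<beta> * n) \<and>
         (\<forall>l\<in>{1..k}. \<alpha> \<le> \<alpha>s l) \<and>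
         is_blow_up s F (\<lambda>i. real (N i) + \<epsilon> * n) V EB \<and>
         EG \<subseteq> EB \<and> c \<in> EG \<rightarrow> {1..k} \<and>
         (\<forall>u\<in>(\<Union>i\<in>{1..s}. V i). real (vertex_degree EB u) - \<delta> * n \<le> real (vertex_degree EG u)) \<and>
         no_large_connected_matchings mt k0 k (\<lambda>l. \<alpha>s l * n) EG c
         \<longrightarrow>
         (\<exists>(V' :: nat \<Rightarrow> 'v set) (EB' :: 'v set set) (c' :: 'v set \<Rightarrow> nat).
            is_blow_up s F (\<lambda>i. real (N i)) V' EB' \<and>
            c' \<in> EB' \<rightarrow> {1..k} \<and>
            no_large_connected_matchings mt k0 k (\<lambda>l. \<alpha>s l * n) EB' c' \<and>
            (\<forall>i\<in>{1..s}. V' i \<subseteq> V i) \<and>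
            (\<forall>e\<in>EG. e \<subseteq> (\<Union>i\<in>{1..s}. V' i) \<longrightarrow> e \<in> EB' \<and> c' e = c e))"
\<comment> \<open>The choice 1 is valid because \<open>delta_bound\<close> holds for every positive
  \<epsilon>.\<close>
proof (intro exI[of _ 1] conjI allI impI)
  show "0 < (1 :: real)" by simp
next
  fix \<epsilon> \<delta> n :: real and N :: "nat \<Rightarrow> nat" and \<alpha>s :: "nat \<Rightarrow> real" and V :: "nat \<Rightarrow> 'v set"
    and EB EG :: "'v set set" and c :: "'v set \<Rightarrow> nat"
  let ?t = "\<lambda>l. \<alpha>s l * n"
  assume H: "0 < \<epsilon> \<and> \<epsilon> \<le> 1 \<and>
     \<delta> = \<epsilon> / 2 * (\<alpha> / (56 * real s ^ 3 * \<beta>)) ^ (2 * k) \<and>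
     0 < n \<and>
     (\<forall>i\<in>{1..s}. 0 < N i \<and> real (N i) \<le> \<beta> * n) \<and>
     (\<forall>l\<in>{1..k}. \<alpha> \<le> \<alpha>s l) \<and>
     is_blow_up s F (\<lambda>i. real (N i) + \<epsilon> * n) V EB \<and>
     EG \<subseteq> EB \<and> c \<in> EG \<rightarrow> {1..k} \<and>
     (\<forall>u\<in>(\<Union>i\<in>{1..s}. V i). real (vertex_degree EB u) - \<delta> * n \<le> real (vertex_degree EG u)) \<and>
     no_large_connected_matchings mt k0 k ?t EG c"
  have eps: "0 < \<epsilon>" and n: "0 < n"
    and \<delta>: "\<delta> = \<epsilon> / 2 * (\<alpha> / (56 * real s ^ 3 * \<beta>)) ^ (2 * k)"
    and bu: "is_blow_up s F (\<lambda>i. real (N i) + \<epsilon> * n) V EB"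
    and EG: "EG \<subseteq> EB" "c \<in> EG \<rightarrow> {1..k}" "no_large_connected_matchings mt k0 k ?t EG c"
    and deg: "\<forall>u\<in>(\<Union>i\<in>{1..s}. V i). real (vertex_degree EB u) - \<delta> * n \<le> real (vertex_degree EG u)"
    by (insert H, (elim conjE, assumption)+)
  have V: "\<forall>i\<in>{1..s}. finite (V i)" "\<forall>i\<in>{1..s}. int (card (V i)) = \<lceil>real (N i) + \<epsilon> * n\<rceil>"
    "disjoint_family_on V {1..s}" and EB: "EB = blow_up_edges F V"
    using bu unfolding is_blow_up_def by auto
  have finEB: "finite EB" unfolding EB by (rule blow_up_edges_finite[OF assms(7) V(1)])
  obtain E c' where E: "EG \<subseteq> E" "E \<subseteq> EB" "c' \<in> E \<rightarrow> {1..k}" "\<forall>e\<in>EG. c' e = c e"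
      "no_large_connected_matchings mt k0 k ?t E c'"
    and maximal: "\<forall>e\<in>EB - E. \<forall>l\<in>{1..k}. \<not> no_large_connected_matchings mt k0 k ?t (insert e E) (c'(e := l))"
    using ex_edge_maximal_extension[of EB EG c k "no_large_connected_matchings mt k0 k ?t", OF finEB EG]
    by (elim exE conjE) (rule that)
  \<comment> \<open>The degree condition bounds the edges missing from \<open>EG\<close>, and
    \<open>E\<close> misses no more.\<close>
  have missing: "\<forall>u\<in>(\<Union>i\<in>{1..s}. V i). real (card {e\<in>EB - E. u \<in> e}) \<le> \<delta> * n"
  proof
    fix u assume "u \<in> (\<Union>i\<in>{1..s}. V i)"
    then have "real (vertex_degree EB u) - \<delta> * n \<le> real (vertex_degree EG u)" using deg by blast
    moreover have "vertex_degree EG u \<le> vertex_degree E u"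
      using E(1,2) finEB by (intro vertex_degree_mono) (auto intro: finite_subset)
    moreover have "card {e\<in>EB - E. u \<in> e} + vertex_degree E u = vertex_degree EB u"
      by (rule vertex_degree_diff[OF finEB E(2)])
    ultimately show "real (card {e\<in>EB - E. u \<in> e}) \<le> \<delta> * n" by linarith
  qed
  have two: "card e = 2" if "e \<in> EB" for e using that unfolding EB by (auto elim: blow_up_edgesE)
  obtain W where W: "is_matching W" "W \<subseteq> EB - E" "\<forall>e\<in>EB - E. e \<inter> \<Union>W \<noteq> {}"
    using ex_maximal_matching[of "EB - E"] finEB two by auto
  have W_small: "real (card (\<Union>W)) \<le> \<epsilon> * n"
  proof (cases "W = {}")
    case True
    then show ?thesis using eps n by simp
  next
    case False
    have "real (card W) \<le> real (s ^ 2 * 10 ^ k) * (\<delta> * n)"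
      by (rule missing_matching_small[OF assms(1,4,7) V(1) EB E(2,3,5) maximal missing W(1,2) False])
    then have "real (card (\<Union>W)) \<le> 2 * (real (s ^ 2 * 10 ^ k) * \<delta>) * n"
      using card_Union_matching[OF W(1)] by simp
    also have "\<dots> \<le> \<epsilon> * n"
      using delta_bound[OF assms(2) _ assms(5,6) eps, of k] assms(3,4) n unfolding \<delta>
      by (intro mult_right_mono) auto
    finally show ?thesis .
  qed
  have finUW: "finite (\<Union>W)"
    using W(1,2) finEB by (metis card.infinite finite_Diff finite_Union finite_subset is_matching_def zero_neq_numeral)
  \<comment> \<open>Since \<open>N i\<close> is an integer, the blob has exactly \<open>N i\<close>
    plus the ceiling of \<open>\<epsilon> * n\<close> vertices. Deleting the vertex cover
    \<open>\<Union>W\<close> therefore leaves at least \<open>N i\<close> of them.\<close>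
  have "\<exists>T\<subseteq>V i - \<Union>W. card T = N i" if i: "i \<in> {1..s}" for i
  proof -
    have "int (card (V i)) = int (N i) + \<lceil>\<epsilon> * n\<rceil>" 
      using V(2) i ceiling_add_of_int[of "\<epsilon> * n" "int (N i)"] by (simp add: add.commute)
    moreover have "int (card (\<Union>W)) \<le> \<lceil>\<epsilon> * n\<rceil>" using W_small by linarith
    moreover have "card (V i) - card (\<Union>W) \<le> card (V i - \<Union>W)" by (rule diff_card_le_card_Diff[OF finUW])
    ultimately have "N i \<le> card (V i - \<Union>W)" by linarith
    then show ?thesis by (metis obtain_subset_with_card_n)
  qed
  then obtain V' where V': "\<And>i. i \<in> {1..s} \<Longrightarrow> V' i \<subseteq> V i - \<Union>W \<and> card (V' i) = N i"
    by (metis (no_types))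
  define EB' where "EB' = blow_up_edges F V'"
  \<comment> \<open>A missing edge would meet \<open>\<Union>W\<close>, which the sets
    \<open>V' i\<close> avoid.\<close>
  have EB'E: "EB' \<subseteq> E"
  proof
    fix e assume "e \<in> EB'"
    then obtain x y i j where e: "{i, j} \<in> F" "x \<in> V' i" "y \<in> V' j" "x \<noteq> y" "e = {x, y}"
      unfolding EB'_def by (rule blow_up_edgesE)
    have "i \<in> {1..s}" "j \<in> {1..s}" using loop_graph_onD[OF assms(7) e(1)] .
    then have xy: "x \<in> V i - \<Union>W" "y \<in> V j - \<Union>W" using V' e(2,3) by blast+
    then have "e \<in> EB" unfolding EB e(5) using e(1,4) by (intro blow_up_edgesI) auto
    moreover have "e \<inter> \<Union>W = {}" using xy e(5) by auto
    ultimately show "e \<in> E" using W(3) by blast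
  qed
  have finV': "finite (V' i)" if "i \<in> {1..s}" for i
    using V' V(1) that by (meson finite_Diff finite_subset)
  have "disjoint_family_on V' {1..s}"
    using V(3) V' unfolding disjoint_family_on_def by blast
  then have "is_blow_up s F (\<lambda>i. real (N i)) V' EB'"
    using V' finV' by (auto simp: is_blow_up_def EB'_def)
  moreover have "c' \<in> EB' \<rightarrow> {1..k}" using E(3) EB'E by auto
  moreover have "no_large_connected_matchings mt k0 k ?t EB' c'"
    by (rule no_large_connected_matchings_subset[OF assms(4) E(5) EB'E])
  moreover have "\<forall>i\<in>{1..s}. V' i \<subseteq> V i" using V' by blast
  moreover have "\<forall>e\<in>EG. e \<subseteq> (\<Union>i\<in>{1..s}. V' i) \<longrightarrow> e \<in> EB' \<and> c' e = c e"
  proof (intro ballI impI conjI)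
    fix e assume e: "e \<in> EG" and sub: "e \<subseteq> (\<Union>i\<in>{1..s}. V' i)"
    show "c' e = c e" using E(4) e by blast
    have "e \<in> blow_up_edges F V" using e EG(1) EB by auto
    then obtain x y i j where xy: "{i, j} \<in> F" "x \<in> V i" "y \<in> V j" "x \<noteq> y" "e = {x, y}"
      by (rule blow_up_edgesE)
    have ij: "i \<in> {1..s}" "j \<in> {1..s}" using loop_graph_onD[OF assms(7) xy(1)] .
    \<comment> \<open>The assumption on \<open>e\<close> only puts \<open>z\<close> into some
      \<open>V' m'\<close>; disjointness of the blobs identifies \<open>m'\<close> with
      \<open>m\<close>.\<close>
    have "z \<in> V' m" if z: "z \<in> e" "z \<in> V m" "m \<in> {1..s}" for z m
    proof -
      obtain m' where m': "m' \<in> {1..s}" "z \<in> V' m'" using sub z(1) by auto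
      then have "z \<in> V m'" using V' by blast
      then have "m' = m" using V(3) z m'(1) unfolding disjoint_family_on_def by blast
      then show ?thesis using m' by simp
    qed
    then show "e \<in> EB'" unfolding EB'_def using xy ij by (auto intro!: blow_up_edgesI)
  qed
  ultimately show "\<exists>V' EB' c'. is_blow_up s F (\<lambda>i. real (N i)) V' EB' \<and> c' \<in> EB' \<rightarrow> {1..k} \<and>
      no_large_connected_matchings mt k0 k ?t EB' c' \<and> (\<forall>i\<in>{1..s}. V' i \<subseteq> V i) \<and>
      (\<forall>e\<in>EG. e \<subseteq> (\<Union>i\<in>{1..s}. V' i) \<longrightarrow> e \<in> EB' \<and> c' e = c e)"
    by blast
qed

end
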